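(* Let $\alpha>-1$, let $\varphi$ be a parabolic automorphism of $\mathbb{D}$ with Denjoy-Wolff point $a\in\partial\mathbb{D}$, and let $\psi\in H^\infty(\mathbb{D})$ be not identically zero and continuous at the point $a$. If the weighted composition operator $C_{\psi,\varphi}$ is not invertible on $A_\alpha^2(\mathbb{D})$, then the spectrum of $C_{\psi,\varphi}$ on $A_\alpha^2(\mathbb{D})$ is $$\left\{\lambda\in\mathbb{C}:|\lambda|\leqslant|\psi(a)|\right\}.$$
   Context: $\mathbb{D}$ is the open unit disk in $\mathbb{C}$. For $\alpha>-1$, the weighted Bergman space $A_\alpha^2(\mathbb{D})$ is the Hilbert space of analytic functions $f$ on $\mathbb{D}$ with $\|f\|^2=\int_{\mathbb{D}}|f(z)|^2\,\frac{1+\alpha}{\pi}(1-|z|^2)^\alpha\,dA(z)<\infty$, where $dA$ is Lebesgue area measure. $H^\infty(\mathbb{D})$ is the space of bounded analytic functions on $\mathbb{D}$. For an automorphism $\varphi$ of $\mathbb{D}$ and $\psi\in H^\infty(\mathbb{D})$, $C_{\psi,\varphi}$ is the bounded operator $C_{\psi,\varphi}f=\psi\cdot(f\circ\varphi)$. An automorphism of $\mathbb{D}$ (extended to $\overline{\mathbb{D}}$) is parabolic if it has no fixed point in $\mathbb{D}$ and only one fixed point on $\partial\mathbb{D}$; this fixed point is its Denjoy-Wolff point, to which its iterates converge uniformly on compact subsets of $\mathbb{D}$. For $c\in\partial\mathbb{D}$, "$\psi$ is continuous at $c$" means that the limit of $\psi(z)$ as $z\to c$, $z\in\mathbb{D}$,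 exists; this limit is denoted $\psi(c)$. *)

theory Defs
  imports "HOL-Complex_Analysis.Complex_Analysis"
begin

abbreviation unit_disk :: "complex set" where
  "unit_disk \<equiv> ball 0 1"

definition bergman_density :: "real \<Rightarrow> (complex \<Rightarrow> complex) \<Rightarrow> complex \<Rightarrow> real" where
  "bergman_density \<alpha> f z = (cmod (f z))\<^sup>2 * ((1 + \<alpha>) / pi * (1 - (cmod z)\<^sup>2) powr \<alpha>)"

text \<open>An analytic function on the disk is represented by its extension by zero to the whole
  plane. Equality of elements is then equality of functions, and the space is closed under the
  pointwise operations.\<close>

definition bergman_space :: "real \<Rightarrow> (complex \<Rightarrow> complex) set" where
  "bergman_space \<alpha> = {f. f holomorphic_on unit_disk \<and> (\<forall>z. z \<notin> unit_disk \<longrightarrow> f z = 0) \<and>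
     set_integrable lborel unit_disk (bergman_density \<alpha> f)}"

definition bergman_norm :: "real \<Rightarrow> (complex \<Rightarrow> complex) \<Rightarrow> real" where
  "bergman_norm \<alpha> f = sqrt (LINT z:unit_disk|lborel. bergman_density \<alpha> f z)"

definition bergman_operator ::
    "real \<Rightarrow> ((complex \<Rightarrow> complex) \<Rightarrow> (complex \<Rightarrow> complex)) \<Rightarrow> bool" where
  "bergman_operator \<alpha> T \<longleftrightarrow>
     (\<forall>f\<in>bergman_space \<alpha>. T f \<in> bergman_space \<alpha>) \<and>
     (\<forall>f\<in>bergman_space \<alpha>. \<forall>g\<in>bergman_space \<alpha>. T (\<lambda>z. f z + g z) = (\<lambda>z. T f z + T g z)) \<and>
     (\<forall>f\<in>bergman_space \<alpha>. \<forall>c. T (\<lambda>z. c * f z) = (\<lambda>z. c * T f z)) \<and>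
     (\<exists>K. \<forall>f\<in>bergman_space \<alpha>. bergman_norm \<alpha> (T f) \<le> K * bergman_norm \<alpha> f)"

text \<open>Invertibility in the algebra of bounded linear operators on the Bergman space. Operators
  are total functions on \<^typ>\<open>complex \<Rightarrow> complex\<close>, but only their values on the Bergman
  space matter.\<close>

definition bergman_invertible ::
    "real \<Rightarrow> ((complex \<Rightarrow> complex) \<Rightarrow> (complex \<Rightarrow> complex)) \<Rightarrow> bool" where
  "bergman_invertible \<alpha> T \<longleftrightarrow> bergman_operator \<alpha> T \<and>
     (\<exists>S. bergman_operator \<alpha> S \<and> (\<forall>f\<in>bergman_space \<alpha>. S (T f) = f \<and> T (S f) = f))"

definition bergman_spectrum ::
    "real \<Rightarrow> ((complex \<Rightarrow> complex) \<Rightarrow> (complex \<Rightarrow> complex)) \<Rightarrow> complex set" where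
  "bergman_spectrum \<alpha> T = {\<mu>. \<not> bergman_invertible \<alpha> (\<lambda>f z. T f z - \<mu> * f z)}"

definition weighted_composition ::
    "(complex \<Rightarrow> complex) \<Rightarrow> (complex \<Rightarrow> complex) \<Rightarrow> (complex \<Rightarrow> complex) \<Rightarrow> (complex \<Rightarrow> complex)" where
  "weighted_composition \<psi> \<phi> f = (\<lambda>z. if z \<in> unit_disk then \<psi> z * f (\<phi> z) else 0)"

definition H_infinity :: "(complex \<Rightarrow> complex) set" where
  "H_infinity = {\<psi>. \<psi> holomorphic_on unit_disk \<and> bounded (\<psi> ` unit_disk)}"

definition disk_automorphism :: "(complex \<Rightarrow> complex) \<Rightarrow> bool" where
  "disk_automorphism \<phi> \<longleftrightarrow> \<phi> holomorphic_on unit_disk \<and> bij_betw \<phi> unit_disk unit_disk"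

text \<open>The value at a boundary point of the continuous extension of an automorphism to the closed
  disk is the limit from inside the disk; the values that the function \<open>\<phi>\<close> itself takes outside
  the open disk are irrelevant.\<close>

definition boundary_fixed_point :: "(complex \<Rightarrow> complex) \<Rightarrow> complex \<Rightarrow> bool" where
  "boundary_fixed_point \<phi> c \<longleftrightarrow> c \<in> sphere 0 1 \<and> (\<phi> \<longlongrightarrow> c) (at c within unit_disk)"

definition parabolic_automorphism :: "(complex \<Rightarrow> complex) \<Rightarrow> bool" where
  "parabolic_automorphism \<phi> \<longleftrightarrow> disk_automorphism \<phi> \<and>
     (\<forall>z\<in>unit_disk. \<phi> z \<noteq> z) \<and> (\<exists>!c. boundary_fixed_point \<phi> c)"

definition denjoy_wolff_point :: "(complex \<Rightarrow> complex) \<Rightarrow> complex \<Rightarrow> bool" where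
  "denjoy_wolff_point \<phi> a \<longleftrightarrow>
     (\<forall>K. compact K \<and> K \<subseteq> unit_disk \<longrightarrow>
        uniform_limit K (\<lambda>n. \<phi> ^^ n) (\<lambda>_. a) sequentially)"

end

theory Submission
  imports Defs "HOL-Real_Asymp.Real_Asymp"
begin

text \<open>The Cayley transform with pole at \<open>a\<close> turns a parabolic automorphism with Denjoy-Wolff
  point \<open>a\<close> into a translation \<open>w \<mapsto> w + t\<close> of the upper half-plane, with \<open>t\<close> real and nonzero
  (\<open>parabolic_automorphism_is_flow\<close>). Two features of translations decide everything. Their
  iterates grow slowly: composition with \<open>w \<mapsto> w + s\<close> has norm at most \<open>(1 + \<bar>s\<bar>)\<close> to the power
  \<open>\<alpha> + 2\<close> on the Bergman space (\<open>bergman_flow_composition\<close>). And a neighbourhood of \<open>a\<close> corresponds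
  to the outside of a bounded set, so an orbit has only a bounded number of points outside such a
  neighbourhood, uniformly in the orbit (\<open>translates_in_disk_bound\<close>). Hence, up to arbitrarily small exponential
  errors, products of \<open>\<bar>\<psi>\<bar>\<close> along an orbit are at most powers of \<open>\<bar>\<psi>a\<bar>\<close>, and also at least such powers
  if \<open>\<psi>\<close> is not close to zero at the exceptional points.

  \<^bold>\<open>Upper bound.\<close> The \<open>n\<close>-th power of the operator multiplies by \<open>n\<close> values of \<open>\<psi>\<close> along an orbit and
  composes with \<open>w \<mapsto> w + n t\<close>. By the two facts above its norm is at most a power of \<open>1 + n \<bar>t\<bar>\<close> times
  a multiple of \<open>p ^ n\<close> for every \<open>p > \<bar>\<psi>a\<bar>\<close>, so for \<open>\<bar>\<mu>\<bar> > \<bar>\<psi>a\<bar>\<close> the Neumann series inverts the operator minus \<open>\<mu>\<close>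
  (\<open>weighted_flow_resolvent\<close>).

  \<^bold>\<open>Lower bound.\<close> If \<open>\<psi>\<close> were bounded away from zero, the operator would be invertible
  (\<open>weighted_flow_invertible\<close>); so \<open>\<psi>\<close> takes arbitrarily small values. Let \<open>0 < \<bar>\<mu>\<bar> < \<bar>\<psi>a\<bar>\<close> and suppose
  that the equation \<open>\<psi> (g \<circ> \<phi>) - \<mu> g = f\<close> always has a solution with norm at most \<open>K\<close> times that of
  \<open>f\<close>. Take a backward orbit \<open>z 0, z 1, ...\<close> such that \<open>\<psi>\<close> is tiny at \<open>z 0\<close> but not at the later
  points, and a function \<open>f\<close> which vanishes at the later points but is as large at \<open>z 0\<close> as its norm
  permits, up to a constant. At \<open>z 0\<close> the equation forces \<open>\<mu> g (z 0)\<close> to be comparable to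
  \<open>f (z 0)\<close>; at the later points it becomes a recursion, which multiplies \<open>g\<close> by \<open>\<psi> / \<mu>\<close> at each
  step. So \<open>g\<close> grows exponentially along the orbit, whereas functions of bounded norm
  grow only polynomially there: a contradiction (\<open>weighted_flow_not_invertible\<close>). How small \<open>\<psi>\<close>
  must be at \<open>z 0\<close> depends only on \<open>K\<close> and fixed data, so one argument covers both
  zeros of \<open>\<psi>\<close> inside the disk and values tending to zero at the boundary.

  The point \<open>0\<close> is in the spectrum by assumption, and the circle \<open>\<bar>\<mu>\<bar> = \<bar>\<psi>a\<bar>\<close> because invertibility is
  stable under small perturbations (\<open>bergman_invertible_stable\<close>).

  The size of point evaluations enters only through a near-extremal function at \<open>z 0\<close> (\<open>bergman_near_extremal\<close>), and
  the norm bound for compositions compares evaluations at different points of one orbit.\<close>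

section \<open>Change of variables for injective holomorphic maps\<close>

text \<open>Bridges the nonnegative Lebesgue integral with respect to Borel measure and the
  gauge-integral formulation in which the change of variables theorem is stated.\<close>

lemma nn_integral_eq_iff_absolutely_integrable:
  fixes f :: "'a::euclidean_space \<Rightarrow> real"
  assumes A: "A \<in> sets borel" and m: "set_borel_measurable borel A f"
    and nn: "\<And>x. x \<in> A \<Longrightarrow> 0 \<le> f x" and b: "0 \<le> b"
  shows "(\<integral>\<^sup>+x\<in>A. ennreal (f x) \<partial>lborel) = ennreal b \<longleftrightarrow>
         f absolutely_integrable_on A \<and> integral A f = b"
proof -
  let ?g = "\<lambda>x. indicator A x * f x"
  have mg: "?g \<in> borel_measurable lborel"
    using m by (simp add: set_borel_measurable_def)
  have ab: "f absolutely_integrable_on A \<longleftrightarrow> integrable lborel ?g"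
    using integrable_completion[OF mg] by (simp add: set_integrable_def)
  have int: "integral A f = integral\<^sup>L lborel ?g" if "integrable lborel ?g"
    using set_borel_integral_eq_integral(2)[of A f] that
    by (simp add: set_integrable_def set_lebesgue_integral_def)
  have eq: "(\<integral>\<^sup>+x\<in>A. ennreal (f x) \<partial>lborel) = (\<integral>\<^sup>+x. ennreal (?g x) \<partial>lborel)"
    by (intro nn_integral_cong) (auto simp: indicator_def)
  have nng: "0 \<le> ?g x" for x using nn by (auto simp: indicator_def)
  show ?thesis
  proof
    assume "(\<integral>\<^sup>+x\<in>A. ennreal (f x) \<partial>lborel) = ennreal b"
    then have e: "(\<integral>\<^sup>+x. ennreal (?g x) \<partial>lborel) = ennreal b" using eq by simp
    have i: "integrable lborel ?g"
      using integrableI_nn_integral_finite[OF mg _ e] nng by simp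
    have "integral\<^sup>L lborel ?g = b"
      using integral_eq_nn_integral[OF mg] nng e b by simp
    then show "f absolutely_integrable_on A \<and> integral A f = b" using ab int i by auto
  next
    assume "f absolutely_integrable_on A \<and> integral A f = b"
    then have i: "integrable lborel ?g" "integral\<^sup>L lborel ?g = b" using ab int by auto
    show "(\<integral>\<^sup>+x\<in>A. ennreal (f x) \<partial>lborel) = ennreal b"
      using nn_integral_eq_integral[OF i(1)] nng i(2) eq by simp
  qed
qed

text \<open>The change of variables theorem concerns Cartesian powers of the reals; these two maps
  transport it to the complex plane.\<close>

definition plane :: "real^2 \<Rightarrow> complex" where "plane v = Complex (v$1) (v$2)"
definition coords :: "complex \<Rightarrow> real^2" where "coords z = vector [Re z, Im z]"

lemma plane_coords [simp]: "plane (coords z) = z" "coords (plane v) = v"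
  by (simp_all add: plane_def coords_def vec_eq_iff forall_2 complex_eq_iff)

lemma linear_plane: "linear plane" "linear coords"
  by (auto intro!: linearI simp: plane_def coords_def complex_eq_iff vec_eq_iff forall_2)

lemma continuous_plane: "continuous_on S plane" "continuous_on T coords"
  using linear_plane linear_continuous_on linear_conv_bounded_linear by blast+

lemma distr_plane: "distr lborel borel plane = lborel"
proof (rule lborel_eqI[symmetric])
  show "sets (distr lborel borel plane) = sets borel" by simp
next
  fix l u :: complex
  assume lu: "\<And>b. b \<in> Basis \<Longrightarrow> l \<bullet> b \<le> u \<bullet> b"
  have m: "plane \<in> measurable lborel borel"
    using borel_measurable_continuous_onI[OF continuous_plane(1)] by simp
  have v: "plane -` box l u = box (coords l) (coords u)"
    by (auto simp: mem_box_cart in_box_complex_iff plane_def coords_def forall_2)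
  have "emeasure (distr lborel borel plane) (box l u) = emeasure lborel (box (coords l) (coords u))"
    using m by (subst emeasure_distr) (auto simp: v)
  also have "\<dots> = (\<Prod>b\<in>Basis. (u - l) \<bullet> b)"
  proof -
    have B: "Basis = {axis (1::2) (1::real), axis 2 1} \<and> axis (1::2) (1::real) \<noteq> axis 2 1"
      by (auto simp: Basis_vec_def UNIV_2 axis_eq_axis)
    have l12: "Re l \<le> Re u" "Im l \<le> Im u" 
      using lu[of 1] lu[of \<i>] by (auto simp: Basis_complex_def inner_complex_def)
    show ?thesis using l12
      by (subst emeasure_lborel_box)
         (auto simp: B inner_axis coords_def Basis_complex_def inner_complex_def)
  qed
  finally show "emeasure (distr lborel borel plane) (box l u) = (\<Prod>b\<in>Basis. (u - l) \<bullet> b)" .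
qed

lemma nn_integral_plane:
  assumes "f \<in> borel_measurable borel"
  shows "(\<integral>\<^sup>+z. f z \<partial>lborel) = (\<integral>\<^sup>+v. f (plane v) \<partial>lborel)"
proof -
  have m: "plane \<in> measurable lborel borel"
    using borel_measurable_continuous_onI[OF continuous_plane(1)] by simp
  have "(\<integral>\<^sup>+z. f z \<partial>lborel) = (\<integral>\<^sup>+z. f z \<partial>distr lborel borel plane)"
    by (simp add: distr_plane)
  also have "\<dots> = (\<integral>\<^sup>+v. f (plane v) \<partial>lborel)"
    using assms m by (subst nn_integral_distr) auto
  finally show ?thesis .
qed

lemma det_complex_multiplication:
  "det (matrix (\<lambda>v. coords (c * plane v))) = (cmod c)\<^sup>2"
  by (simp add: det_2 matrix_def coords_def plane_def axis_def cmod_power2)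
     (simp add: power2_eq_square)

lemma set_borel_measurable_continuous_open:
  fixes f :: "'a::euclidean_space \<Rightarrow> real"
  assumes "open A" "continuous_on A f"
  shows "set_borel_measurable borel A f"
  using borel_measurable_continuous_on_indicator[of A f] assms
  by (simp add: set_borel_measurable_def)

lemma ennreal_eq_by_finite_values: 
  fixes X Y :: ennreal
  assumes "\<And>b. 0 \<le> b \<Longrightarrow> X = ennreal b \<longleftrightarrow> Y = ennreal b"
  shows "X = Y"
proof (cases X)
  case (real r) then show ?thesis using assms[of r] by simp
next
  case top then show ?thesis using assms by (cases Y) fastforce+
qed

text \<open>The real Jacobian of a holomorphic map is the squared modulus of its derivative, because
  multiplication by \<open>c\<close> has determinant \<open>\<bar>c\<bar>\<^sup>2\<close> as a map of the plane. For nonnegative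
  integrands the equality includes the case that both sides are infinite.\<close>

theorem nn_integral_change_of_variables_holomorphic:
  fixes g :: "complex \<Rightarrow> complex" and F :: "complex \<Rightarrow> real"
  assumes S: "open S" and g: "g holomorphic_on S" and inj: "inj_on g S"
    and F: "continuous_on (g ` S) F" and nn: "\<And>w. w \<in> g ` S \<Longrightarrow> 0 \<le> F w"
  shows "(\<integral>\<^sup>+w\<in>g ` S. ennreal (F w) \<partial>lborel) =
         (\<integral>\<^sup>+z\<in>S. ennreal ((cmod (deriv g z))\<^sup>2 * F (g z)) \<partial>lborel)"
proof (rule ennreal_eq_by_finite_values)
  fix b :: real assume b: "0 \<le> b"
  define T where "T = coords ` S"
  define G where "G = (\<lambda>v. coords (g (plane v)))"
  define G' where "G' = (\<lambda>v h. coords (deriv g (plane v) * plane h))"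
  define f where "f = (\<lambda>v. vec (F (plane v)) :: real^1)"
  have T_vim: "T = plane -` S"
    unfolding T_def by (auto simp: image_iff) (metis plane_coords(2))
  have oT: "open T" unfolding T_vim using continuous_plane(1)[of UNIV] S
    by (simp add: continuous_on_open_vimage)
  have gS: "open (g ` S)" using open_mapping_thm3[OF g S inj] .
  have GT_vim: "G ` T = plane -` (g ` S)"
    unfolding T_def G_def by (auto simp: image_iff) (metis plane_coords(2))
  have oGT: "open (G ` T)" unfolding GT_vim using continuous_plane(1)[of UNIV] gS
    by (simp add: continuous_on_open_vimage)
  have der: "(G has_derivative G' v) (at v within T)" if "v \<in> T" for v
  proof -
    have "plane v \<in> S" using that T_vim by auto
    then have d: "(g has_derivative (*) (deriv g (plane v))) (at (plane v))"
      using g S holomorphic_derivI has_field_derivative_def by blast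
    have p: "(plane has_derivative plane) (at v)" "(coords has_derivative coords) (at w)" for w
      using linear_plane by (auto intro: linear_imp_has_derivative)
    have "(G has_derivative G' v) (at v)"
      using has_derivative_compose[OF has_derivative_compose[OF p(1) d] p(2)]
      by (simp add: G_def G'_def)
    then show ?thesis by (rule has_derivative_at_withinI)
  qed
  have injG: "inj_on G T"
    using inj unfolding inj_on_def G_def T_def by (auto) (metis plane_coords(1))
  have det: "det (matrix (G' v)) = (cmod (deriv g (plane v)))\<^sup>2" for v
    unfolding G'_def by (rule det_complex_multiplication)
  have cov: "(\<lambda>v. \<bar>det (matrix (G' v))\<bar> *\<^sub>R f (G v)) absolutely_integrable_on T \<and>
     integral T (\<lambda>v. \<bar>det (matrix (G' v))\<bar> *\<^sub>R f (G v)) = vec b \<longleftrightarrow>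
     f absolutely_integrable_on G ` T \<and> integral (G ` T) f = vec b"
    using oT by (intro has_absolute_integral_change_of_variables der injG) auto
  have v1: "(\<lambda>v. f v $ 1) = (\<lambda>v. F (plane v))"
    by (simp add: f_def)
  have v2: "(\<lambda>v. (\<bar>det (matrix (G' v))\<bar> *\<^sub>R f (G v)) $ 1) =
      (\<lambda>v. (cmod (deriv g (plane v)))\<^sup>2 * F (g (plane v)))"
    by (simp add: f_def det G_def)
  have cov': "(\<lambda>v. (cmod (deriv g (plane v)))\<^sup>2 * F (g (plane v))) absolutely_integrable_on T \<and>
     integral T (\<lambda>v. (cmod (deriv g (plane v)))\<^sup>2 * F (g (plane v))) = b \<longleftrightarrow>
     (\<lambda>v. F (plane v)) absolutely_integrable_on G ` T \<and> integral (G ` T) (\<lambda>v. F (plane v)) = b"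
    using cov unfolding absolutely_integrable_on_1_iff integral_on_1_eq v1 v2
    by (simp add: vec_eq_iff)
  have c1: "continuous_on S (\<lambda>z. (cmod (deriv g z))\<^sup>2 * F (g z))"
    using g S F by (intro continuous_intros holomorphic_on_imp_continuous_on holomorphic_deriv
        continuous_on_compose2[OF F]) auto
  have c2: "continuous_on T (\<lambda>v. (cmod (deriv g (plane v)))\<^sup>2 * F (g (plane v)))"
    by (rule continuous_on_compose2[OF c1 continuous_plane(1)]) (auto simp: T_vim)
  have c3: "continuous_on (G ` T) (\<lambda>v. F (plane v))"
    by (rule continuous_on_compose2[OF F continuous_plane(1)]) (auto simp: GT_vim)
  have L: "(\<integral>\<^sup>+w\<in>g ` S. ennreal (F w) \<partial>lborel) = (\<integral>\<^sup>+v\<in>G ` T. ennreal (F (plane v)) \<partial>lborel)"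
  proof -
    have "(\<lambda>w. ennreal (indicator (g ` S) w * F w)) \<in> borel_measurable borel"
      using set_borel_measurable_continuous_open[OF gS F] by (simp add: set_borel_measurable_def)
    moreover have "(\<lambda>w. ennreal (indicator (g ` S) w * F w)) = (\<lambda>w. ennreal (F w) * indicator (g ` S) w)"
      by (auto simp: indicator_def)
    ultimately show ?thesis
      by (subst nn_integral_plane) (auto intro!: nn_integral_cong simp: GT_vim indicator_def)
  qed
  have R: "(\<integral>\<^sup>+z\<in>S. ennreal ((cmod (deriv g z))\<^sup>2 * F (g z)) \<partial>lborel) =
      (\<integral>\<^sup>+v\<in>T. ennreal ((cmod (deriv g (plane v)))\<^sup>2 * F (g (plane v))) \<partial>lborel)"
  proof -
    let ?h = "\<lambda>z. (cmod (deriv g z))\<^sup>2 * F (g z)"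
    have "(\<lambda>w. ennreal (indicator S w * ?h w)) \<in> borel_measurable borel"
      using set_borel_measurable_continuous_open[OF S c1] by (simp add: set_borel_measurable_def)
    moreover have "(\<lambda>w. ennreal (indicator S w * ?h w)) = (\<lambda>w. ennreal (?h w) * indicator S w)"
      by (auto simp: indicator_def)
    ultimately show ?thesis
      by (subst nn_integral_plane) (auto intro!: nn_integral_cong simp: T_vim indicator_def)
  qed
  show "(\<integral>\<^sup>+w\<in>g ` S. ennreal (F w) \<partial>lborel) = ennreal b \<longleftrightarrow>
        (\<integral>\<^sup>+z\<in>S. ennreal ((cmod (deriv g z))\<^sup>2 * F (g z)) \<partial>lborel) = ennreal b"
    unfolding L R
  proof -
    have "(\<integral>\<^sup>+v\<in>G ` T. ennreal (F (plane v)) \<partial>lborel) = ennreal b \<longleftrightarrow>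
      (\<lambda>v. F (plane v)) absolutely_integrable_on G ` T \<and> integral (G ` T) (\<lambda>v. F (plane v)) = b"
      using nn b oGT
      by (intro nn_integral_eq_iff_absolutely_integrable set_borel_measurable_continuous_open c3)
        (auto simp: GT_vim)
    moreover have "(\<integral>\<^sup>+v\<in>T. ennreal ((cmod (deriv g (plane v)))\<^sup>2 * F (g (plane v))) \<partial>lborel) = ennreal b \<longleftrightarrow>
      (\<lambda>v. (cmod (deriv g (plane v)))\<^sup>2 * F (g (plane v))) absolutely_integrable_on T \<and>
       integral T (\<lambda>v. (cmod (deriv g (plane v)))\<^sup>2 * F (g (plane v))) = b"
      using nn b oT
      by (intro nn_integral_eq_iff_absolutely_integrable set_borel_measurable_continuous_open c2)
        (auto simp: T_vim)
    ultimately show "(\<integral>\<^sup>+v\<in>G ` T. ennreal (F (plane v)) \<partial>lborel) = ennreal b \<longleftrightarrow>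
        (\<integral>\<^sup>+v\<in>T. ennreal ((cmod (deriv g (plane v)))\<^sup>2 * F (g (plane v))) \<partial>lborel) = ennreal b"
      using cov' by simp
  qed
qed

section \<open>Area mean values of holomorphic functions\<close>

text \<open>Cauchy's formula at the centre of the circle about \<open>z\<close> through \<open>w\<close>. It is written with the
  whole circle as the rotations of the single point \<open>w\<close>, so that \<open>w\<close> can be integrated over a disk
  afterwards.\<close>

lemma circle_mean_inequality:
  assumes F: "F holomorphic_on S" and S: "open S" "cball z r \<subseteq> S" and w: "w \<in> ball z r"
  shows "ennreal (cmod (F z)) \<le>
    (\<integral>\<^sup>+x\<in>{0..1}. ennreal (cmod (F (z + exp (2 * of_real pi * \<i> * of_real x) * (w - z)))) \<partial>lborel)"
proof -
  define e where "e = (\<lambda>x::real. exp (2 * of_real pi * \<i> * of_real x))"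
  define h where "h = (\<lambda>u. F (z + u * (w - z)))"
  define p where "p = (\<lambda>x. F (z + e x * (w - z)))"
  have "z + u * (w - z) \<in> S" if "u \<in> cball 0 1" for u
  proof -
    have "cmod u * cmod (w - z) \<le> 1 * r"
      using that w by (intro mult_mono) (auto simp: dist_norm norm_minus_commute)
    then show ?thesis using S by (auto simp: dist_norm norm_mult)
  qed
  then have sub: "(\<lambda>u. z + u * (w - z)) ` cball 0 1 \<subseteq> S" by auto
  have h: "h holomorphic_on cball 0 1"
    unfolding h_def by (intro holomorphic_on_compose_gen[OF _ F sub, unfolded o_def] holomorphic_intros)
  have "((\<lambda>u. h u / (u - 0)) has_contour_integral (2 * of_real pi * \<i> * h 0)) (circlepath 0 1)"
    using h by (intro Cauchy_integral_circlepath_simple) auto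
  then have "((\<lambda>x. h (e x) / e x * (2 * pi * \<i> * e x)) has_integral 2 * of_real pi * \<i> * h 0) {0..1}"
    unfolding has_contour_integral vector_derivative_circlepath
    by (simp add: circlepath e_def)
  then have "((\<lambda>x. h (e x) / e x * (2 * pi * \<i> * e x) / (2 * pi * \<i>)) has_integral
      2 * of_real pi * \<i> * h 0 / (2 * pi * \<i>)) {0..1}"
    by (rule has_integral_divide)
  then have hi: "(p has_integral F z) {0..1}"
    by (simp add: h_def p_def e_def)
  have ce: "continuous_on {0..1} e" unfolding e_def by (intro continuous_intros)
  have ne: "e x \<in> cball 0 1" for x by (simp add: e_def norm_exp_eq_Re)
  have cp: "continuous_on {0..1} p"
    using continuous_on_compose2[OF holomorphic_on_imp_continuous_on[OF h] ce image_subsetI[OF ne]]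
    by (simp add: p_def h_def)
  have "p absolutely_integrable_on {0..1}"
    using absolutely_integrable_continuous_real[OF cp] .
  then have i: "(\<lambda>x. cmod (p x)) integrable_on {0..1}" and n: "cmod (F z) \<le> integral {0..1} (\<lambda>x. cmod (p x))"
    using absolutely_integrable_on_def integral_norm_bound_integral[of p "{0..1}" "\<lambda>x. cmod (p x)"] hi
      integral_unique[OF hi] by auto
  have "(\<integral>\<^sup>+x\<in>{0..1}. ennreal (cmod (p x)) \<partial>lborel) = ennreal (integral {0..1} (\<lambda>x. cmod (p x)))"
    using nn_integral_eq_iff_absolutely_integrable[of "{0..1}" "\<lambda>x. cmod (p x)"]
      absolutely_integrable_continuous_real[OF continuous_on_norm[OF cp]]
      borel_measurable_continuous_on_indicator[OF _ continuous_on_norm[OF cp]]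
    by (simp add: set_borel_measurable_def integral_nonneg i)
  then show ?thesis using n by (simp add: ennreal_leI p_def e_def)
qed

text \<open>The integral over a disk is invariant under rotations about its centre, hence equal to its
  average over all rotations. By Tonelli the average may be taken first, pointwise in \<open>w\<close>, where
  the mean value inequality on circles bounds it below.\<close>

lemma area_mean_inequality:
  assumes F: "F holomorphic_on S" and S: "open S" "cball z r \<subseteq> S" and r: "0 < r"
  shows "ennreal (cmod (F z) * (pi * r\<^sup>2)) \<le> (\<integral>\<^sup>+w\<in>ball z r. ennreal (cmod (F w)) \<partial>lborel)"
proof -
  define e where "e = (\<lambda>x::real. exp (2 * of_real pi * \<i> * of_real x))"
  define G where "G = (\<lambda>(x::real, w). ennreal (indicator ({0..1} \<times> ball z r) (x, w) * cmod (F (z + e x * (w - z)))))"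
  have ne: "cmod (e x) = 1" for x by (simp add: e_def norm_exp_eq_Re)
  have rot: "(\<integral>\<^sup>+w\<in>ball z r. ennreal (cmod (F w)) \<partial>lborel) =
      (\<integral>\<^sup>+w\<in>ball z r. ennreal (cmod (F (z + e x * (w - z)))) \<partial>lborel)" for x
  proof -
    define g where "g = (\<lambda>w. z + e x * (w - z))"
    have im: "g ` ball z r = ball z r"
    proof -
      have "w \<in> g ` ball z r" if "w \<in> ball z r" for w
      proof (rule image_eqI)
        show "w = g (z + (w - z) / e x)" by (simp add: g_def e_def)
        show "z + (w - z) / e x \<in> ball z r"
          using that ne by (simp add: dist_norm norm_divide norm_minus_commute)
      qed
      moreover have "g w \<in> ball z r" if "w \<in> ball z r" for w
        using that ne by (simp add: g_def dist_norm norm_mult norm_minus_commute)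
      ultimately show ?thesis by auto
    qed
    have inj: "inj_on g (ball z r)" by (auto simp: g_def inj_on_def e_def)
    have hg: "g holomorphic_on ball z r" unfolding g_def by (intro holomorphic_intros)
    have d: "deriv g w = e x" for w
      unfolding g_def by (intro DERIV_imp_deriv) (auto intro!: derivative_eq_intros)
    have "continuous_on (g ` ball z r) (\<lambda>w. cmod (F w))"
      unfolding im using S(2) by (intro continuous_on_norm holomorphic_on_imp_continuous_on
        holomorphic_on_subset[OF F]) auto
    from nn_integral_change_of_variables_holomorphic[OF open_ball hg inj this]
    show ?thesis unfolding im by (simp add: d ne) (simp add: g_def)
  qed
  have cG: "continuous_on ({0..1} \<times> ball z r) (\<lambda>(x, w). cmod (F (z + e x * (w - z))))"
  proof -
    have 1: "continuous_on ({0..1} \<times> ball z r) (\<lambda>p. z + e (fst p) * (snd p - z))"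
      unfolding e_def by (intro continuous_intros)
    have 2: "(\<lambda>p. z + e (fst p) * (snd p - z)) ` ({0..1} \<times> ball z r) \<subseteq> S"
      using S(2) ne by (force simp: dist_norm norm_mult norm_minus_commute)
    show ?thesis
      using continuous_on_norm[OF continuous_on_compose2[OF holomorphic_on_imp_continuous_on[OF F] 1 2]]
      by (simp add: case_prod_unfold)
  qed
  have mG: "G \<in> borel_measurable (lborel \<Otimes>\<^sub>M lborel)"
  proof -
    have "(\<lambda>p. indicator ({0..1} \<times> ball z r) p * (case p of (x, w) \<Rightarrow> cmod (F (z + e x * (w - z)))))
       \<in> borel_measurable borel"
      using borel_measurable_continuous_on_indicator[OF _ cG] borel_Times[of "{0..1::real}" "ball z r"]
      by simp
    then show ?thesis unfolding G_def by (simp add: lborel_prod case_prod_unfold)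
  qed
  have "ennreal (cmod (F z) * (pi * r\<^sup>2)) = (\<integral>\<^sup>+w\<in>ball z r. ennreal (cmod (F z)) \<partial>lborel)"
    using r by (simp add: nn_integral_cmult_indicator emeasure_ball unit_ball_vol_2 ennreal_mult)
  also have "\<dots> \<le> (\<integral>\<^sup>+w. (\<integral>\<^sup>+x. G (x, w) \<partial>lborel) \<partial>lborel)"
  proof (rule nn_integral_mono)
    fix w
    show "ennreal (cmod (F z)) * indicator (ball z r) w \<le> (\<integral>\<^sup>+x. G (x, w) \<partial>lborel)"
    proof (cases "w \<in> ball z r")
      case True
      have "(\<integral>\<^sup>+x. G (x, w) \<partial>lborel) = (\<integral>\<^sup>+x\<in>{0..1}. ennreal (cmod (F (z + e x * (w - z)))) \<partial>lborel)"
        using True by (intro nn_integral_cong) (auto simp: G_def indicator_def)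
      then show ?thesis using circle_mean_inequality[OF F S True] True by (simp add: e_def)
    qed simp
  qed
  also have "\<dots> = (\<integral>\<^sup>+x. (\<integral>\<^sup>+w. G (x, w) \<partial>lborel) \<partial>lborel)"
    using lborel_pair.Fubini'[of "\<lambda>x w. G (x, w)"] mG by simp
  also have "\<dots> = (\<integral>\<^sup>+x\<in>{0..1::real}. (\<integral>\<^sup>+w\<in>ball z r. ennreal (cmod (F w)) \<partial>lborel) \<partial>lborel)"
  proof (rule nn_integral_cong)
    fix x :: real
    have "(\<integral>\<^sup>+w. G (x, w) \<partial>lborel) =
      (\<integral>\<^sup>+w. ennreal (cmod (F (z + e x * (w - z)))) * indicator (ball z r) w * indicator {0..1} x \<partial>lborel)"
      by (intro nn_integral_cong) (auto simp: G_def indicator_def)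
    then show "(\<integral>\<^sup>+w. G (x, w) \<partial>lborel) =
       (\<integral>\<^sup>+w\<in>ball z r. ennreal (cmod (F w)) \<partial>lborel) * indicator {0..1} x"
      by (cases "x \<in> {0..1}") (simp_all add: rot[of x])
  qed
  also have "\<dots> = (\<integral>\<^sup>+w\<in>ball z r. ennreal (cmod (F w)) \<partial>lborel)"
    by (simp add: nn_integral_cmult_indicator)
  finally show ?thesis .
qed

section \<open>The Bergman space: norm, addition and point evaluations\<close>

definition disk_weight :: "real \<Rightarrow> complex \<Rightarrow> real" where
  "disk_weight \<alpha> z = (1 + \<alpha>) / pi * (1 - (cmod z)\<^sup>2) powr \<alpha>"

lemma bergman_density_weight: "bergman_density \<alpha> f z = (cmod (f z))\<^sup>2 * disk_weight \<alpha> z"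
  by (simp add: bergman_density_def disk_weight_def)

text \<open>The squared Bergman norm as an extended nonnegative number, defined before integrability is
  known.\<close>

definition bergman_energy :: "real \<Rightarrow> (complex \<Rightarrow> complex) \<Rightarrow> ennreal" where
  "bergman_energy \<alpha> f = (\<integral>\<^sup>+z\<in>unit_disk. ennreal (bergman_density \<alpha> f z) \<partial>lborel)"

lemma unit_disk_defect_pos: "z \<in> unit_disk \<Longrightarrow> 0 < 1 - (cmod z)\<^sup>2"
  by (simp add: power_less_one_iff abs_square_less_1)

lemma disk_weight_nonneg: "\<alpha> > -1 \<Longrightarrow> 0 \<le> disk_weight \<alpha> z"
  by (simp add: disk_weight_def)

lemma continuous_disk_weight: "continuous_on unit_disk (disk_weight \<alpha>)"
proof -
  have "1 - (cmod z)\<^sup>2 \<noteq> 0" if "z \<in> unit_disk" for z using unit_disk_defect_pos[OF that] by linarith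
  then show ?thesis unfolding disk_weight_def by (intro continuous_intros) auto
qed

lemma continuous_bergman_density:
  assumes "f holomorphic_on unit_disk"
  shows "continuous_on unit_disk (bergman_density \<alpha> f)"
  unfolding bergman_density_weight[abs_def]
  by (intro continuous_intros continuous_disk_weight holomorphic_on_imp_continuous_on assms)

lemma measurable_bergman_density:
  assumes "f holomorphic_on unit_disk"
  shows "(\<lambda>z. ennreal (bergman_density \<alpha> f z) * indicator unit_disk z) \<in> borel_measurable borel"
proof -
  have "(\<lambda>z. ennreal (indicator unit_disk z * bergman_density \<alpha> f z)) \<in> borel_measurable borel"
    using set_borel_measurable_continuous_open[OF open_ball continuous_bergman_density[OF assms]]
    by (simp add: set_borel_measurable_def)
  also have "(\<lambda>z. ennreal (indicator unit_disk z * bergman_density \<alpha> f z)) =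
      (\<lambda>z. ennreal (bergman_density \<alpha> f z) * indicator unit_disk z)"
    by (auto simp: indicator_def)
  finally show ?thesis .
qed

context
  fixes \<alpha> :: real assumes \<alpha>: "\<alpha> > -1"
begin

lemma bergman_density_nonneg: "0 \<le> bergman_density \<alpha> f z"
  using disk_weight_nonneg[OF \<alpha>] by (simp add: bergman_density_weight)

lemma bergman_norm_nonneg: "0 \<le> bergman_norm \<alpha> f"
  unfolding bergman_norm_def set_lebesgue_integral_def
  by (intro real_sqrt_ge_zero integral_nonneg_AE AE_I2) (simp add: bergman_density_nonneg)

lemma bergman_energy_norm:
  assumes "f \<in> bergman_space \<alpha>"
  shows "bergman_energy \<alpha> f = ennreal ((bergman_norm \<alpha> f)\<^sup>2)"
proof -
  let ?g = "\<lambda>z. indicator unit_disk z * bergman_density \<alpha> f z"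
  have i: "integrable lborel ?g" using assms by (simp add: bergman_space_def set_integrable_def)
  have "bergman_energy \<alpha> f = (\<integral>\<^sup>+z. ennreal (?g z) \<partial>lborel)"
    unfolding bergman_energy_def by (intro nn_integral_cong) (auto simp: indicator_def)
  also have "\<dots> = ennreal (integral\<^sup>L lborel ?g)"
    using i by (intro nn_integral_eq_integral) (auto simp: bergman_density_nonneg)
  also have "integral\<^sup>L lborel ?g = (bergman_norm \<alpha> f)\<^sup>2"
    by (simp add: bergman_norm_def set_lebesgue_integral_def integral_nonneg_AE bergman_density_nonneg)
  finally show ?thesis .
qed

lemma bergman_spaceI:
  assumes "f holomorphic_on unit_disk" "\<And>z. z \<notin> unit_disk \<Longrightarrow> f z = 0"
    and E: "bergman_energy \<alpha> f \<le> ennreal (c\<^sup>2)" and c: "0 \<le> c"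
  shows "f \<in> bergman_space \<alpha>" "bergman_norm \<alpha> f \<le> c"
proof -
  let ?g = "\<lambda>z. indicator unit_disk z * bergman_density \<alpha> f z"
  have m: "?g \<in> borel_measurable lborel"
    using set_borel_measurable_continuous_open[OF open_ball continuous_bergman_density[OF assms(1)]]
    by (simp add: set_borel_measurable_def)
  have "(\<integral>\<^sup>+z. ennreal (?g z) \<partial>lborel) = bergman_energy \<alpha> f"
    unfolding bergman_energy_def by (intro nn_integral_cong) (auto simp: indicator_def)
  then have "(\<integral>\<^sup>+z. ennreal (?g z) \<partial>lborel) < \<infinity>" using E by (simp add: le_less_trans)
  then have "integrable lborel ?g"
    using m by (intro integrableI_nonneg) (auto simp: bergman_density_nonneg)
  then show f: "f \<in> bergman_space \<alpha>"
    using assms by (simp add: bergman_space_def set_integrable_def)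
  have "(bergman_norm \<alpha> f)\<^sup>2 \<le> c\<^sup>2"
    using E bergman_energy_norm[OF f] by (simp add: ennreal_le_iff)
  then show "bergman_norm \<alpha> f \<le> c" using c by (rule power2_le_imp_le)
qed

lemma bergman_spaceD:
  assumes "f \<in> bergman_space \<alpha>"
  shows "f holomorphic_on unit_disk" "z \<notin> unit_disk \<Longrightarrow> f z = 0"
  using assms by (auto simp: bergman_space_def)

lemma bergman_dominated:
  assumes f: "f \<in> bergman_space \<alpha>" and h: "h holomorphic_on unit_disk" "\<And>z. z \<notin> unit_disk \<Longrightarrow> h z = 0"
    and le: "\<And>z. z \<in> unit_disk \<Longrightarrow> cmod (h z) \<le> M * cmod (f z)" and M: "0 \<le> M"
  shows "h \<in> bergman_space \<alpha>" "bergman_norm \<alpha> h \<le> M * bergman_norm \<alpha> f"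
proof -
  have "bergman_energy \<alpha> h \<le> (\<integral>\<^sup>+z. ennreal (M\<^sup>2) * (ennreal (bergman_density \<alpha> f z) * indicator unit_disk z) \<partial>lborel)"
    unfolding bergman_energy_def
  proof (rule nn_integral_mono)
    fix z
    have "bergman_density \<alpha> h z \<le> M\<^sup>2 * bergman_density \<alpha> f z" if "z \<in> unit_disk"
    proof -
      have "(cmod (h z))\<^sup>2 \<le> (M * cmod (f z))\<^sup>2" using le[OF that] by (intro power_mono) auto
      then show ?thesis
        unfolding bergman_density_weight using disk_weight_nonneg[OF \<alpha>, of z]
        by (simp add: mult_right_mono power_mult_distrib mult.assoc[symmetric])
    qed
    then show "ennreal (bergman_density \<alpha> h z) * indicator unit_disk z
       \<le> ennreal (M\<^sup>2) * (ennreal (bergman_density \<alpha> f z) * indicator unit_disk z)"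
      by (auto simp: indicator_def ennreal_mult''[symmetric] bergman_density_nonneg intro!: ennreal_leI)
  qed
  also have "\<dots> = ennreal (M\<^sup>2) * bergman_energy \<alpha> f"
    unfolding bergman_energy_def
    using measurable_bergman_density[OF bergman_spaceD(1)[OF f]] by (subst nn_integral_cmult) auto
  also have "\<dots> = ennreal ((M * bergman_norm \<alpha> f)\<^sup>2)"
    by (simp add: bergman_energy_norm[OF f] ennreal_mult power_mult_distrib)
  finally have E: "bergman_energy \<alpha> h \<le> ennreal ((M * bergman_norm \<alpha> f)\<^sup>2)" .
  show "h \<in> bergman_space \<alpha>" "bergman_norm \<alpha> h \<le> M * bergman_norm \<alpha> f"
    using bergman_spaceI[OF h E] M bergman_norm_nonneg by auto
qed

lemma bergman_scale:
  assumes "f \<in> bergman_space \<alpha>"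
  shows "(\<lambda>z. c * f z) \<in> bergman_space \<alpha>"
    "bergman_norm \<alpha> (\<lambda>z. c * f z) \<le> cmod c * bergman_norm \<alpha> f"
  using bergman_dominated[OF assms holomorphic_on_mult[OF holomorphic_on_const bergman_spaceD(1)[OF assms]],
      of c "cmod c"] bergman_spaceD(2)[OF assms]
  by (auto simp: norm_mult)

text \<open>The factor 2 is not sharp: it comes from \<open>\<bar>x + y\<bar>\<^sup>2 \<le> 2 \<bar>x\<bar>\<^sup>2 + 2 \<bar>y\<bar>\<^sup>2\<close>, and all that matters is
  that sums of bounded operators are bounded.\<close>

lemma bergman_add:
  assumes f: "f \<in> bergman_space \<alpha>" and g: "g \<in> bergman_space \<alpha>"
  shows "(\<lambda>z. f z + g z) \<in> bergman_space \<alpha>"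
    "bergman_norm \<alpha> (\<lambda>z. f z + g z) \<le> 2 * (bergman_norm \<alpha> f + bergman_norm \<alpha> g)"
proof -
  let ?h = "\<lambda>z. f z + g z"
  let ?d = "\<lambda>f z. ennreal (bergman_density \<alpha> f z) * indicator unit_disk z"
  have "bergman_energy \<alpha> ?h \<le> (\<integral>\<^sup>+z. 2 * ?d f z + 2 * ?d g z \<partial>lborel)"
    unfolding bergman_energy_def
  proof (rule nn_integral_mono)
    fix z
    have "(cmod (f z + g z))\<^sup>2 \<le> (cmod (f z) + cmod (g z))\<^sup>2"
      by (intro power_mono norm_triangle_ineq) auto
    also have "\<dots> \<le> 2 * (cmod (f z))\<^sup>2 + 2 * (cmod (g z))\<^sup>2"
      using sum_squares_bound[of "cmod (f z)" "cmod (g z)"] by (simp add: power2_sum)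
    finally have "bergman_density \<alpha> ?h z \<le> 2 * bergman_density \<alpha> f z + 2 * bergman_density \<alpha> g z"
      unfolding bergman_density_weight using disk_weight_nonneg[OF \<alpha>, of z]
      by (metis (no_types, lifting) mult.assoc mult_right_mono distrib_right)
    then have "ennreal (bergman_density \<alpha> ?h z) \<le> ennreal (2 * bergman_density \<alpha> f z + 2 * bergman_density \<alpha> g z)"
      by (rule ennreal_leI)
    also have "\<dots> = 2 * ennreal (bergman_density \<alpha> f z) + 2 * ennreal (bergman_density \<alpha> g z)"
      by (simp add: ennreal_plus bergman_density_nonneg ennreal_mult')
    finally show "?d ?h z \<le> 2 * ?d f z + 2 * ?d g z"
      by (auto simp: indicator_def)
  qed
  also have "\<dots> = 2 * bergman_energy \<alpha> f + 2 * bergman_energy \<alpha> g"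
    using measurable_bergman_density bergman_spaceD(1)[OF f] bergman_spaceD(1)[OF g]
    by (simp add: bergman_energy_def nn_integral_add nn_integral_cmult)
  also have "\<dots> = ennreal (2 * (bergman_norm \<alpha> f)\<^sup>2 + 2 * (bergman_norm \<alpha> g)\<^sup>2)"
    by (simp add: bergman_energy_norm f g ennreal_plus ennreal_mult')
  also have "\<dots> \<le> ennreal ((2 * (bergman_norm \<alpha> f + bergman_norm \<alpha> g))\<^sup>2)"
    using bergman_norm_nonneg[of f] bergman_norm_nonneg[of g]
    by (intro ennreal_leI) (simp add: power2_eq_square algebra_simps)
  finally have E: "bergman_energy \<alpha> ?h \<le> ennreal ((2 * (bergman_norm \<alpha> f + bergman_norm \<alpha> g))\<^sup>2)" .
  have "?h holomorphic_on unit_disk" using f g bergman_spaceD by (intro holomorphic_intros) auto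
  from bergman_spaceI[OF this _ E] show "?h \<in> bergman_space \<alpha>"
    "bergman_norm \<alpha> ?h \<le> 2 * (bergman_norm \<alpha> f + bergman_norm \<alpha> g)"
    using bergman_spaceD(2)[OF f] bergman_spaceD(2)[OF g] bergman_norm_nonneg by auto
qed

text \<open>Area mean value inequality for \<open>f\<^sup>2\<close> on a disk that stays away from the unit circle, where the
  weight is bounded below.\<close>

lemma bergman_point_evaluation:
  assumes r: "0 \<le> r" "r < 1"
  obtains C where "0 \<le> C" "\<And>f z. f \<in> bergman_space \<alpha> \<Longrightarrow> cmod z \<le> r \<Longrightarrow> cmod (f z) \<le> C * bergman_norm \<alpha> f"
proof -
  define d where "d = (1 - r) / 2"
  \<comment> \<open>a lower bound for the weight, valid for both signs of \<open>\<alpha>\<close>\<close>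
  define m where "m = (1 + \<alpha>) / pi * min 1 ((1 - (r + d)\<^sup>2) powr \<alpha>)"
  have d: "0 < d" "r + d < 1" using r by (auto simp: d_def field_simps)
  have rd: "0 < 1 - (r + d)\<^sup>2" using d r by (simp add: abs_square_less_1)
  have m: "0 < m" using \<alpha> rd by (simp add: m_def)
  have wm: "m \<le> disk_weight \<alpha> w" if "cmod w \<le> r + d" for w
  proof -
    define u where "u = 1 - (cmod w)\<^sup>2"
    have u: "1 - (r + d)\<^sup>2 \<le> u" "u \<le> 1"
      using that d r by (auto simp: u_def intro!: power_mono)
    have "min 1 ((1 - (r + d)\<^sup>2) powr \<alpha>) \<le> u powr \<alpha>"
    proof (cases "\<alpha> \<ge> 0")
      case True
      then show ?thesis using powr_mono2[of \<alpha>, OF True _ u(1)] rd by simp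
    next
      case False
      have "1 powr \<alpha> \<le> u powr \<alpha>" using False u rd by (intro powr_mono2') auto
      then show ?thesis by simp
    qed
    then show ?thesis using \<alpha> by (simp add: m_def disk_weight_def u_def divide_right_mono mult_left_mono)
  qed
  define C where "C = 1 / sqrt (pi * d\<^sup>2 * m)"
  show ?thesis
  proof
    show "0 \<le> C" using m d by (simp add: C_def)
    fix f z assume f: "f \<in> bergman_space \<alpha>" and z: "cmod z \<le> r"
    have hf: "(\<lambda>w. (f w)\<^sup>2) holomorphic_on unit_disk"
      using bergman_spaceD(1)[OF f] by (intro holomorphic_intros)
    have sub: "cmod w \<le> r + d" if "w \<in> cball z d" for w
    proof -
      have "cmod w \<le> cmod z + cmod (w - z)" using norm_triangle_ineq[of z "w - z"] by simp
      then show ?thesis using that z by (simp add: dist_norm norm_minus_commute)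
    qed
    have sub': "cball z d \<subseteq> unit_disk" using sub d by force
    have mm: "(\<lambda>w. ennreal (cmod ((f w)\<^sup>2)) * indicator (ball z d) w) \<in> borel_measurable borel"
    proof -
      have "continuous_on (ball z d) (\<lambda>w. cmod ((f w)\<^sup>2))"
        using sub' by (intro continuous_on_norm continuous_on_subset[OF holomorphic_on_imp_continuous_on[OF hf]]) auto
      from set_borel_measurable_continuous_open[OF open_ball this]
      have "(\<lambda>w. ennreal (indicator (ball z d) w * cmod ((f w)\<^sup>2))) \<in> borel_measurable borel"
        by (simp add: set_borel_measurable_def)
      also have "(\<lambda>w. ennreal (indicator (ball z d) w * cmod ((f w)\<^sup>2))) = 
        (\<lambda>w. ennreal (cmod ((f w)\<^sup>2)) * indicator (ball z d) w)"
        by (auto simp: indicator_def)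
      finally show ?thesis .
    qed
    have "ennreal m * ennreal (cmod ((f z)\<^sup>2) * (pi * d\<^sup>2)) \<le>
      ennreal m * (\<integral>\<^sup>+w\<in>ball z d. ennreal (cmod ((f w)\<^sup>2)) \<partial>lborel)"
      by (intro mult_left_mono area_mean_inequality[OF hf open_ball sub' d(1)]) auto
    also have "\<dots> = (\<integral>\<^sup>+w. ennreal m * (ennreal (cmod ((f w)\<^sup>2)) * indicator (ball z d) w) \<partial>lborel)"
      using mm by (subst nn_integral_cmult) auto
    also have "\<dots> \<le> bergman_energy \<alpha> f"
      unfolding bergman_energy_def
    proof (rule nn_integral_mono)
      fix w
      show "ennreal m * (ennreal (cmod ((f w)\<^sup>2)) * indicator (ball z d) w)
        \<le> ennreal (bergman_density \<alpha> f w) * indicator unit_disk w"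
      proof (cases "w \<in> ball z d")
        case True
        then have "m \<le> disk_weight \<alpha> w" using sub wm by auto
        then have "m * (cmod (f w))\<^sup>2 \<le> bergman_density \<alpha> f w"
          by (simp add: bergman_density_weight mult.commute[of "(cmod (f w))\<^sup>2"] mult_right_mono)
        moreover have "w \<in> unit_disk" using True sub' subsetD[OF sub', of w] by simp
        ultimately show ?thesis using True m
          by (simp add: ennreal_mult'[symmetric] norm_power ennreal_leI)
      qed simp
    qed
    also have "\<dots> = ennreal ((bergman_norm \<alpha> f)\<^sup>2)" by (rule bergman_energy_norm[OF f])
    finally have "m * (cmod ((f z)\<^sup>2) * (pi * d\<^sup>2)) \<le> (bergman_norm \<alpha> f)\<^sup>2"
      using m by (simp add: ennreal_mult'[symmetric] ennreal_le_iff)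
    then have "(cmod (f z))\<^sup>2 \<le> (bergman_norm \<alpha> f)\<^sup>2 / (pi * d\<^sup>2 * m)"
      using m d by (simp add: norm_power field_simps)
    also have "\<dots> = (C * bergman_norm \<alpha> f)\<^sup>2"
      using m d by (simp add: C_def power_mult_distrib power_divide)
    finally show "cmod (f z) \<le> C * bergman_norm \<alpha> f"
      by (rule power2_le_imp_le) (use m d bergman_norm_nonneg in \<open>simp add: C_def\<close>)
  qed
qed

end

section \<open>Convergent series in the Bergman space and Neumann series\<close>

text \<open>The Cauchy-Schwarz inequality for \<open>s n = sqrt (c n) * (s n / sqrt (c n))\<close>. It replaces the
  triangle inequality for infinite sums in an \<open>L\<^sup>2\<close> space: integrating the right-hand side term by
  term gives the square of \<open>suminf c\<close> as soon as the \<open>n\<close>-th term has norm at most \<open>c n\<close>.\<close>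

lemma weighted_Cauchy_Schwarz_series:
  fixes a c :: "nat \<Rightarrow> real" and s :: "nat \<Rightarrow> complex"
  assumes s: "s sums l" and c: "\<And>n. 0 < c n" "summable c"
  shows "ennreal ((cmod l)\<^sup>2) \<le> ennreal (suminf c) * (\<Sum>n. ennreal ((cmod (s n))\<^sup>2 / c n))"
proof (rule LIMSEQ_le_const2)
  have "(\<lambda>n. (cmod (\<Sum>i<n. s i))\<^sup>2) \<longlonglongrightarrow> (cmod l)\<^sup>2"
    using s unfolding sums_def by (intro tendsto_intros)
  then show "(\<lambda>n. ennreal ((cmod (\<Sum>i<n. s i))\<^sup>2)) \<longlonglongrightarrow> ennreal ((cmod l)\<^sup>2)"
    by (rule tendsto_ennrealI)
  have "ennreal ((cmod (\<Sum>i<n. s i))\<^sup>2) \<le> ennreal (suminf c) * (\<Sum>n. ennreal ((cmod (s n))\<^sup>2 / c n))" for n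
  proof -
    have "(cmod (\<Sum>i<n. s i))\<^sup>2 \<le> (\<Sum>i<n. sqrt (c i) * (cmod (s i) / sqrt (c i)))\<^sup>2"
    proof (rule power_mono)
      have "cmod (\<Sum>i<n. s i) \<le> (\<Sum>i<n. cmod (s i))" by (rule norm_sum)
      also have "\<dots> = (\<Sum>i<n. sqrt (c i) * (cmod (s i) / sqrt (c i)))"
        using c(1) by (intro sum.cong) (auto simp: less_imp_neq[THEN not_sym])
      finally show "cmod (\<Sum>i<n. s i) \<le> (\<Sum>i<n. sqrt (c i) * (cmod (s i) / sqrt (c i)))" .
    qed simp
    also have "\<dots> \<le> (\<Sum>i<n. (sqrt (c i))\<^sup>2) * (\<Sum>i<n. (cmod (s i) / sqrt (c i))\<^sup>2)"
      by (rule Cauchy_Schwarz_ineq_sum)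
    also have "\<dots> = (\<Sum>i<n. c i) * (\<Sum>i<n. (cmod (s i))\<^sup>2 / c i)"
      using c(1) by (simp add: power_divide less_imp_le)
    finally have "ennreal ((cmod (\<Sum>i<n. s i))\<^sup>2) \<le> ennreal ((\<Sum>i<n. c i) * (\<Sum>i<n. (cmod (s i))\<^sup>2 / c i))"
      by (rule ennreal_leI)
    also have "\<dots> = ennreal (\<Sum>i<n. c i) * (\<Sum>i<n. ennreal ((cmod (s i))\<^sup>2 / c i))"
      using c(1) by (simp add: ennreal_mult sum_nonneg less_imp_le sum_ennreal)
    also have "\<dots> \<le> ennreal (suminf c) * (\<Sum>n. ennreal ((cmod (s n))\<^sup>2 / c n))"
      using c by (intro mult_mono ennreal_leI sum_le_suminf) (auto simp: less_imp_le)
    finally show ?thesis .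
  qed
  then show "\<exists>N. \<forall>n\<ge>N. ennreal ((cmod (\<Sum>i<n. s i))\<^sup>2) \<le>
      ennreal (suminf c) * (\<Sum>n. ennreal ((cmod (s n))\<^sup>2 / c n))"
    by blast
qed

context
  fixes \<alpha> :: real assumes \<alpha>: "\<alpha> > -1"
begin

text \<open>Completeness of the Bergman space, in the form needed for Neumann series. Point evaluations
  are bounded locally uniformly, so the series converges locally uniformly to a holomorphic function;
  the weighted Cauchy-Schwarz inequality bounds its norm. The factor \<open>B\<close> lets the
  norm estimate be linear in the vector to which a series of operators is applied.\<close>

lemma bergman_series:
  assumes f: "\<And>n. f n \<in> bergman_space \<alpha>" and le: "\<And>n. bergman_norm \<alpha> (f n) \<le> c n * B"
    and c: "\<And>n. 0 < c n" "summable c" and B: "0 \<le> B"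
  shows "summable (\<lambda>n. f n z)" "(\<lambda>z. \<Sum>n. f n z) \<in> bergman_space \<alpha>"
    "bergman_norm \<alpha> (\<lambda>z. \<Sum>n. f n z) \<le> suminf c * B"
proof -
  define F where "F = (\<lambda>z. \<Sum>n. f n z)"
  have bd: "\<exists>C. \<forall>n z. cmod z \<le> r \<longrightarrow> cmod (f n z) \<le> C * c n" if r: "0 \<le> r" "r < 1" for r
  proof -
    obtain C where C: "0 \<le> C" "\<And>f z. f \<in> bergman_space \<alpha> \<Longrightarrow> cmod z \<le> r \<Longrightarrow> cmod (f z) \<le> C * bergman_norm \<alpha> f"
      using bergman_point_evaluation[OF \<alpha> r] by metis
    have "cmod (f n z) \<le> (C * B) * c n" if "cmod z \<le> r" for n z
    proof -
      have "cmod (f n z) \<le> C * bergman_norm \<alpha> (f n)" using C(2) f that by blast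
      also have "\<dots> \<le> C * (c n * B)" using le C(1) by (intro mult_left_mono) auto
      finally show ?thesis by (simp add: mult_ac)
    qed
    then show ?thesis by blast
  qed
  show sm: "summable (\<lambda>n. f n z)" for z
  proof (cases "z \<in> unit_disk")
    case True
    then obtain C where "\<And>n. cmod (f n z) \<le> C * c n" using bd[of "cmod z"] by auto
    then show ?thesis using c(2) by (intro summable_comparison_test[OF _ summable_mult[OF c(2), of C]]) auto
  next
    case False
    then show ?thesis using bergman_spaceD(2)[OF \<alpha> f] by simp
  qed
  have hF: "F holomorphic_on unit_disk"
  proof (rule holomorphic_uniform_sequence[OF open_ball])
    show "(\<lambda>z. \<Sum>i<n. f i z) holomorphic_on unit_disk" for n
      using bergman_spaceD(1)[OF \<alpha> f] by (intro holomorphic_intros)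
    fix x assume x: "x \<in> unit_disk"
    define d where "d = (1 - cmod x) / 2"
    have d: "0 < d" "cmod x + d < 1" using x by (auto simp: d_def field_simps)
    have sub: "cmod w \<le> cmod x + d" if "w \<in> cball x d" for w
    proof -
      have "cmod w \<le> cmod x + cmod (w - x)" using norm_triangle_ineq[of x "w - x"] by simp
      then show ?thesis using that by (simp add: dist_norm norm_minus_commute)
    qed
    obtain C where "\<And>n z. cmod z \<le> cmod x + d \<Longrightarrow> cmod (f n z) \<le> C * c n" using bd[of "cmod x + d"] d by auto
    then have "uniform_limit (cball x d) (\<lambda>n x. \<Sum>i<n. f i x) F sequentially"
      unfolding F_def using sub summable_mult[OF c(2), of C]
      by (intro Weierstrass_m_test[where M="\<lambda>n. C * c n"]) auto
    then show "\<exists>d>0. cball x d \<subseteq> unit_disk \<and> uniform_limit (cball x d) (\<lambda>n x. \<Sum>i<n. f i x) F sequentially"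
      using d sub by (intro exI[of _ d]) force
  qed
  let ?d = "\<lambda>f z. ennreal (bergman_density \<alpha> f z) * indicator unit_disk z"
  have m: "?d (f n) \<in> borel_measurable borel" for n
    by (rule measurable_bergman_density[OF bergman_spaceD(1)[OF \<alpha> f]])
  have "bergman_energy \<alpha> F \<le> (\<integral>\<^sup>+z. ennreal (suminf c) * (\<Sum>n. ennreal (1 / c n) * ?d (f n) z) \<partial>lborel)"
    unfolding bergman_energy_def
  proof (rule nn_integral_mono)
    fix z
    show "?d F z \<le> ennreal (suminf c) * (\<Sum>n. ennreal (1 / c n) * ?d (f n) z)"
    proof (cases "z \<in> unit_disk")
      case True
      have eq: "ennreal (1 / c n) * ?d (f n) z = ennreal ((cmod (f n z))\<^sup>2 / c n) * ennreal (disk_weight \<alpha> z)" for n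
        using True c(1)[of n] disk_weight_nonneg[OF \<alpha>]
        by (simp add: ennreal_mult'[symmetric] bergman_density_weight mult_ac)
      have "?d F z = ennreal ((cmod (F z))\<^sup>2) * ennreal (disk_weight \<alpha> z)"
        using True by (simp add: bergman_density_weight ennreal_mult')
      also have "\<dots> \<le> (ennreal (suminf c) * (\<Sum>n. ennreal ((cmod (f n z))\<^sup>2 / c n))) * ennreal (disk_weight \<alpha> z)"
        unfolding F_def
        by (intro mult_right_mono weighted_Cauchy_Schwarz_series summable_sums sm c) auto
      also have "\<dots> = ennreal (suminf c) * (\<Sum>n. ennreal (1 / c n) * ?d (f n) z)"
        unfolding eq by (simp add: mult.assoc)
      finally show ?thesis .
    qed simp
  qed
  also have "\<dots> = ennreal (suminf c) * (\<Sum>n. ennreal (1 / c n) * bergman_energy \<alpha> (f n))"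
    using m by (simp add: nn_integral_cmult nn_integral_suminf bergman_energy_def)
  also have "\<dots> \<le> ennreal (suminf c) * (\<Sum>n. ennreal (c n * B\<^sup>2))"
  proof (intro mult_left_mono suminf_le)
    fix n
    have "(bergman_norm \<alpha> (f n))\<^sup>2 \<le> (c n * B)\<^sup>2"
      using le bergman_norm_nonneg[OF \<alpha>] by (intro power_mono) auto
    then have "1 / c n * (bergman_norm \<alpha> (f n))\<^sup>2 \<le> c n * B\<^sup>2"
      using c(1)[of n] by (simp add: field_simps power2_eq_square)
    then show "ennreal (1 / c n) * bergman_energy \<alpha> (f n) \<le> ennreal (c n * B\<^sup>2)"
      using c(1)[of n] by (simp add: bergman_energy_norm[OF \<alpha> f] ennreal_mult'[symmetric] ennreal_leI)
  qed auto
  also have "\<dots> = ennreal ((suminf c * B)\<^sup>2)"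
  proof -
    have "(\<Sum>n. ennreal (c n * B\<^sup>2)) = ennreal (\<Sum>n. c n * B\<^sup>2)"
      using c by (intro suminf_ennreal2 summable_mult2) (auto simp: less_imp_le)
    also have "(\<Sum>n. c n * B\<^sup>2) = suminf c * B\<^sup>2" using c by (simp add: suminf_mult2)
    finally have "(\<Sum>n. ennreal (c n * B\<^sup>2)) = ennreal (suminf c * B\<^sup>2)" .
    then show ?thesis using c suminf_nonneg[OF c(2)]
      by (simp add: less_imp_le ennreal_mult'[symmetric]) (simp add: power2_eq_square mult_ac)
  qed
  finally have E: "bergman_energy \<alpha> F \<le> ennreal ((suminf c * B)\<^sup>2)" .
  have F0: "F z = 0" if "z \<notin> unit_disk" for z
    using bergman_spaceD(2)[OF \<alpha> f that] by (simp add: F_def)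
  have "0 \<le> suminf c * B" using c suminf_nonneg[OF c(2)] B by (simp add: less_imp_le)
  from bergman_spaceI[OF \<alpha> hF F0 E this]
  show "(\<lambda>z. \<Sum>n. f n z) \<in> bergman_space \<alpha>" "bergman_norm \<alpha> (\<lambda>z. \<Sum>n. f n z) \<le> suminf c * B"
    by (simp_all add: F_def)
qed

lemma bergman_operatorD:
  assumes "bergman_operator \<alpha> T"
  shows "f \<in> bergman_space \<alpha> \<Longrightarrow> T f \<in> bergman_space \<alpha>"
    "f \<in> bergman_space \<alpha> \<Longrightarrow> g \<in> bergman_space \<alpha> \<Longrightarrow> T (\<lambda>z. f z + g z) = (\<lambda>z. T f z + T g z)"
    "f \<in> bergman_space \<alpha> \<Longrightarrow> T (\<lambda>z. c * f z) = (\<lambda>z. c * T f z)"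
    "\<exists>K\<ge>0. \<forall>f\<in>bergman_space \<alpha>. bergman_norm \<alpha> (T f) \<le> K * bergman_norm \<alpha> f"
proof -
  obtain K where K: "\<forall>f\<in>bergman_space \<alpha>. bergman_norm \<alpha> (T f) \<le> K * bergman_norm \<alpha> f"
    using assms by (auto simp: bergman_operator_def)
  have "bergman_norm \<alpha> (T f) \<le> \<bar>K\<bar> * bergman_norm \<alpha> f" if "f \<in> bergman_space \<alpha>" for f
    using K that mult_right_mono[OF abs_ge_self bergman_norm_nonneg[OF \<alpha>], of K f] by fastforce
  then show "\<exists>K\<ge>0. \<forall>f\<in>bergman_space \<alpha>. bergman_norm \<alpha> (T f) \<le> K * bergman_norm \<alpha> f"
    by (intro exI[of _ "\<bar>K\<bar>"]) auto
qed (use assms in \<open>auto simp: bergman_operator_def\<close>)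

lemma bergman_diff:
  assumes "f \<in> bergman_space \<alpha>" "g \<in> bergman_space \<alpha>"
  shows "(\<lambda>z. f z - g z) \<in> bergman_space \<alpha>"
    "bergman_norm \<alpha> (\<lambda>z. f z - g z) \<le> 2 * (bergman_norm \<alpha> f + bergman_norm \<alpha> g)"
  using bergman_add[OF \<alpha> assms(1) bergman_scale(1)[OF \<alpha> assms(2), of "-1"]]
    bergman_scale(2)[OF \<alpha> assms(2), of "-1"] by auto

lemma bergman_operator_diff:
  assumes T: "bergman_operator \<alpha> T" and S: "bergman_operator \<alpha> S"
  shows "bergman_operator \<alpha> (\<lambda>f z. T f z - S f z)"
proof -
  obtain K L where K: "K \<ge> 0" "\<And>f. f \<in> bergman_space \<alpha> \<Longrightarrow> bergman_norm \<alpha> (T f) \<le> K * bergman_norm \<alpha> f"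
    and L: "L \<ge> 0" "\<And>f. f \<in> bergman_space \<alpha> \<Longrightarrow> bergman_norm \<alpha> (S f) \<le> L * bergman_norm \<alpha> f"
    using bergman_operatorD(4)[OF T] bergman_operatorD(4)[OF S] by blast
  have "bergman_norm \<alpha> (\<lambda>z. T f z - S f z) \<le> (2 * (K + L)) * bergman_norm \<alpha> f" if "f \<in> bergman_space \<alpha>" for f
    using bergman_diff(2)[OF bergman_operatorD(1)[OF T that] bergman_operatorD(1)[OF S that]] K(2)[OF that] L(2)[OF that]
    by (simp add: algebra_simps)
  moreover have "(\<lambda>z. T f z - S f z) \<in> bergman_space \<alpha>" if "f \<in> bergman_space \<alpha>" for f
    using bergman_diff(1)[OF bergman_operatorD(1)[OF T that] bergman_operatorD(1)[OF S that]] .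
  ultimately show ?thesis
    unfolding bergman_operator_def
    by (intro conjI ballI allI exI[of _ "2 * (K + L)"])
       (auto simp: bergman_operatorD(2,3)[OF T] bergman_operatorD(2,3)[OF S] algebra_simps)
qed

lemma bergman_operator_compose:
  assumes T: "bergman_operator \<alpha> T" and S: "bergman_operator \<alpha> S"
  shows "bergman_operator \<alpha> (\<lambda>f. T (S f))"
proof -
  obtain K L where K: "K \<ge> 0" "\<And>f. f \<in> bergman_space \<alpha> \<Longrightarrow> bergman_norm \<alpha> (T f) \<le> K * bergman_norm \<alpha> f"
    and L: "L \<ge> 0" "\<And>f. f \<in> bergman_space \<alpha> \<Longrightarrow> bergman_norm \<alpha> (S f) \<le> L * bergman_norm \<alpha> f"
    using bergman_operatorD(4)[OF T] bergman_operatorD(4)[OF S] by blast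
  have "bergman_norm \<alpha> (T (S f)) \<le> (K * L) * bergman_norm \<alpha> f" if "f \<in> bergman_space \<alpha>" for f
    using K(2)[OF bergman_operatorD(1)[OF S that]] mult_left_mono[OF L(2)[OF that] K(1)] by (simp add: mult.assoc)
  then show ?thesis
    unfolding bergman_operator_def
    using bergman_operatorD(1-3)[OF T] bergman_operatorD(1-3)[OF S] by auto
qed

lemma bergman_operator_scale: "bergman_operator \<alpha> (\<lambda>f z. c * f z)"
  unfolding bergman_operator_def
  by (intro conjI ballI allI exI[of _ "cmod c"]) (auto simp: bergman_scale[OF \<alpha>] algebra_simps)

lemma bergman_operator_id: "bergman_operator \<alpha> (\<lambda>f. f)"
  using bergman_operator_scale[of 1] by simp

lemma bergman_invertible_compose:
  assumes "bergman_invertible \<alpha> T" "bergman_invertible \<alpha> S"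
  shows "bergman_invertible \<alpha> (\<lambda>f. T (S f))"
proof -
  obtain T' S' where inv: "bergman_operator \<alpha> T'" "\<forall>f\<in>bergman_space \<alpha>. T' (T f) = f \<and> T (T' f) = f"
    "bergman_operator \<alpha> S'" "\<forall>f\<in>bergman_space \<alpha>. S' (S f) = f \<and> S (S' f) = f"
    and op: "bergman_operator \<alpha> T" "bergman_operator \<alpha> S"
    using assms by (auto simp: bergman_invertible_def)
  have "\<forall>f\<in>bergman_space \<alpha>. S' (T' (T (S f))) = f \<and> T (S (S' (T' f))) = f"
    using inv op bergman_operatorD(1) by metis
  then show ?thesis
    unfolding bergman_invertible_def
    using bergman_operator_compose[OF op] bergman_operator_compose[OF inv(3,1)] by blast
qed

lemma bergman_invertible_scale:
  assumes "c \<noteq> 0" shows "bergman_invertible \<alpha> (\<lambda>f z. c * f z)"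
  unfolding bergman_invertible_def
  using assms bergman_operator_scale[of c] bergman_operator_scale[of "1 / c"]
  by (intro conjI exI[of _ "\<lambda>f z. 1 / c * f z"]) auto

lemma bergman_operator_cong:
  assumes "\<And>f. f \<in> bergman_space \<alpha> \<Longrightarrow> T f = T' f"
  shows "bergman_operator \<alpha> T \<longleftrightarrow> bergman_operator \<alpha> T'"
  unfolding bergman_operator_def
  using assms bergman_add(1)[OF \<alpha>] bergman_scale(1)[OF \<alpha>] by (simp cong: ball_cong)

lemma bergman_invertible_cong:
  assumes "\<And>f. f \<in> bergman_space \<alpha> \<Longrightarrow> T f = T' f"
  shows "bergman_invertible \<alpha> T \<longleftrightarrow> bergman_invertible \<alpha> T'"
proof -
  have "(\<forall>f\<in>bergman_space \<alpha>. S (T f) = f \<and> T (S f) = f) \<longleftrightarrow>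
      (\<forall>f\<in>bergman_space \<alpha>. S (T' f) = f \<and> T' (S f) = f)" if "bergman_operator \<alpha> S" for S
    using assms bergman_operatorD(1)[OF that] by (intro ball_cong) auto
  moreover have "bergman_operator \<alpha> T \<longleftrightarrow> bergman_operator \<alpha> T'"
    using assms by (rule bergman_operator_cong)
  ultimately show ?thesis unfolding bergman_invertible_def by blast
qed

lemma bergman_operator_funpow:
  assumes T: "bergman_operator \<alpha> T" shows "bergman_operator \<alpha> (T ^^ n)"
proof (induction n)
  case 0 show ?case using bergman_operator_id by (simp add: id_def)
next
  case (Suc n)
  then show ?case using bergman_operator_compose[OF T Suc] by (simp add: o_def)
qed

text \<open>The inverse is \<open>S f = (\<Sum>n. (T ^^ n) f)\<close>, summed pointwise. Telescoping gives \<open>S (f - T f) = f\<close>.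
  For the other order it suffices that \<open>T\<close> and \<open>S\<close> commute: \<open>T (S f)\<close> is a partial sum of
  \<open>S (T f)\<close> plus \<open>T (S ((T ^^ m) f))\<close>, and the latter tends to 0.\<close>

theorem bergman_neumann_series:
  assumes T: "bergman_operator \<alpha> T" and c: "\<And>n. 0 < c n" "summable c"
    and le: "\<And>n f. f \<in> bergman_space \<alpha> \<Longrightarrow> bergman_norm \<alpha> ((T ^^ n) f) \<le> c n * bergman_norm \<alpha> f"
  shows "bergman_invertible \<alpha> (\<lambda>f z. f z - T f z)"
proof -
  define S where "S = (\<lambda>f z. \<Sum>n. (T ^^ n) f z)"
  note Tn = bergman_operator_funpow[OF T]
  have mem: "(T ^^ n) f \<in> bergman_space \<alpha>" if "f \<in> bergman_space \<alpha>" for n f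
    using bergman_operatorD(1)[OF Tn that] .
  have sm: "summable (\<lambda>n. (T ^^ n) f z)" 
    and SA: "S f \<in> bergman_space \<alpha>" and SB: "bergman_norm \<alpha> (S f) \<le> suminf c * bergman_norm \<alpha> f"
    if "f \<in> bergman_space \<alpha>" for f z
    using bergman_series[of "\<lambda>n. (T ^^ n) f", OF mem[OF that] le[OF that] c bergman_norm_nonneg[OF \<alpha>]]
    by (simp_all add: S_def)
  have S: "bergman_operator \<alpha> S"
    unfolding bergman_operator_def
  proof (intro conjI ballI allI)
    fix f g assume fg: "f \<in> bergman_space \<alpha>" "g \<in> bergman_space \<alpha>"
    show "S (\<lambda>z. f z + g z) = (\<lambda>z. S f z + S g z)"
      unfolding S_def using bergman_operatorD(2)[OF Tn fg] suminf_add[OF sm[OF fg(1)] sm[OF fg(2)]] by simp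
  next
    fix f c assume f: "f \<in> bergman_space \<alpha>"
    show "S (\<lambda>z. c * f z) = (\<lambda>z. c * S f z)"
      unfolding S_def using bergman_operatorD(3)[OF Tn f] suminf_mult[OF sm[OF f]] by simp
  qed (use SA SB in auto)
  obtain K where K: "K \<ge> 0" "\<And>f. f \<in> bergman_space \<alpha> \<Longrightarrow> bergman_norm \<alpha> (T f) \<le> K * bergman_norm \<alpha> f"
    using bergman_operatorD(4)[OF T] by blast
  have S1: "S f = (\<lambda>z. f z + S (T f) z)" if f: "f \<in> bergman_space \<alpha>" for f
  proof
    fix z show "S f z = f z + S (T f) z"
      using suminf_split_head[OF sm[OF f]] by (simp add: S_def funpow_swap1)
  qed
  have TS1: "T (S f) z = T f z + T (S (T f)) z" if f: "f \<in> bergman_space \<alpha>" for f z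
    using S1[OF f] bergman_operatorD(2)[OF T f SA[OF bergman_operatorD(1)[OF T f]]] by simp
  have TSn: "T (S f) z = (\<Sum>n<m. (T ^^ n) (T f) z) + T (S ((T ^^ m) f)) z" if f: "f \<in> bergman_space \<alpha>" for f z m
  proof (induction m)
    case (Suc m)
    have "T (S ((T ^^ m) f)) z = (T ^^ m) (T f) z + T (S ((T ^^ Suc m) f)) z"
      using TS1[OF mem[OF f, of m]] by (simp add: funpow_swap1)
    then show ?case using Suc by simp
  qed simp
  have TS: "T (S f) = S (T f)" if f: "f \<in> bergman_space \<alpha>" for f
  proof
    fix z
    note Tf = bergman_operatorD(1)[OF T f]
    show "T (S f) z = S (T f) z"
    proof (cases "z \<in> unit_disk")
      case True
      then obtain C where C: "0 \<le> C" "\<And>f. f \<in> bergman_space \<alpha> \<Longrightarrow> cmod (f z) \<le> C * bergman_norm \<alpha> f"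
        using bergman_point_evaluation[OF \<alpha>, of "cmod z"] by (metis mem_ball_0 norm_ge_zero order_refl)
      have "\<forall>m. cmod (T (S ((T ^^ m) f)) z) \<le> (C * K * suminf c * bergman_norm \<alpha> f) * c m"
      proof
        fix m
        have "cmod (T (S ((T ^^ m) f)) z) \<le> C * bergman_norm \<alpha> (T (S ((T ^^ m) f)))"
          by (intro C bergman_operatorD(1)[OF T] SA mem f)
        also have "\<dots> \<le> C * (K * bergman_norm \<alpha> (S ((T ^^ m) f)))"
          by (intro mult_left_mono C K SA mem f)
        also have "\<dots> \<le> C * (K * (suminf c * bergman_norm \<alpha> ((T ^^ m) f)))"
          by (intro mult_left_mono C K SB mem f)
        also have "\<dots> \<le> C * (K * (suminf c * (c m * bergman_norm \<alpha> f)))"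
          using suminf_nonneg[OF c(2)] c(1) by (intro mult_left_mono C K le f) (auto simp: less_imp_le)
        finally show "cmod (T (S ((T ^^ m) f)) z) \<le> (C * K * suminf c * bergman_norm \<alpha> f) * c m"
          by (simp add: mult_ac)
      qed
      moreover have "(\<lambda>m. (C * K * suminf c * bergman_norm \<alpha> f) * c m) \<longlonglongrightarrow> 0"
        using summable_LIMSEQ_zero[OF c(2)] by (rule tendsto_mult_right_zero)
      ultimately have lim0: "(\<lambda>m. T (S ((T ^^ m) f)) z) \<longlonglongrightarrow> 0"
        by (rule Lim_null_comparison[OF always_eventually])
      have "(\<lambda>m. (\<Sum>n<m. (T ^^ n) (T f) z) + T (S ((T ^^ m) f)) z) \<longlonglongrightarrow> S (T f) z + 0"
        using summable_LIMSEQ[OF sm[OF Tf]] lim0 unfolding S_def by (rule tendsto_add)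
      then have "(\<lambda>m. T (S f) z) \<longlonglongrightarrow> S (T f) z" unfolding TSn[OF f, symmetric] by simp
      then show ?thesis by (rule LIMSEQ_unique[OF tendsto_const])
    next
      case False
      then show ?thesis
        using bergman_spaceD(2)[OF \<alpha> SA[OF Tf] False]
          bergman_spaceD(2)[OF \<alpha> bergman_operatorD(1)[OF T SA[OF f]] False] by simp
    qed
  qed
  have "S (\<lambda>z. f z - T f z) = f \<and> (\<lambda>z. S f z - T (S f) z) = f" if f: "f \<in> bergman_space \<alpha>" for f
  proof -
    note Tf = bergman_operatorD(1)[OF T f]
    have "S (\<lambda>z. f z + -1 * T f z) = (\<lambda>z. S f z + -1 * S (T f) z)"
      using bergman_operatorD(2)[OF S f bergman_scale(1)[OF \<alpha> Tf, of "-1"]] bergman_operatorD(3)[OF S Tf, of "-1"] by simp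
    then have "S (\<lambda>z. f z - T f z) = (\<lambda>z. S f z - S (T f) z)" by simp
    moreover have "(\<lambda>z. S f z - S (T f) z) = f"
    proof
      fix z show "S f z - S (T f) z = f z" using fun_cong[OF S1[OF f], of z] by simp
    qed
    ultimately show ?thesis using TS[OF f] by simp
  qed
  then show ?thesis
    unfolding bergman_invertible_def
    using bergman_operator_diff[OF bergman_operator_id T] S by blast
qed

end

context
  fixes \<alpha> :: real assumes \<alpha>: "\<alpha> > -1"
begin

lemma bergman_small_perturbation:
  assumes T: "bergman_operator \<alpha> T" and le: "\<And>f. f \<in> bergman_space \<alpha> \<Longrightarrow> bergman_norm \<alpha> (T f) \<le> 1/2 * bergman_norm \<alpha> f"
  shows "bergman_invertible \<alpha> (\<lambda>f z. f z - T f z)"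
proof (rule bergman_neumann_series[OF \<alpha> T])
  show "bergman_norm \<alpha> ((T ^^ n) f) \<le> (1/2) ^ n * bergman_norm \<alpha> f" if f: "f \<in> bergman_space \<alpha>" for n f
  proof (induction n)
    case (Suc n)
    have "bergman_norm \<alpha> ((T ^^ Suc n) f) \<le> 1/2 * bergman_norm \<alpha> ((T ^^ n) f)"
      using le[OF bergman_operatorD(1)[OF \<alpha> bergman_operator_funpow[OF \<alpha> T] f]] by simp
    then show ?case using Suc by simp
  qed simp
qed (auto intro: summable_geometric)

text \<open>With \<open>S\<close> the inverse of \<open>T\<close>, the perturbed operator is \<open>T\<close> composed with \<open>1 - \<nu> S\<close>.\<close>

lemma bergman_invertible_stable:
  assumes "bergman_invertible \<alpha> T"
  shows "\<exists>\<epsilon>>0. \<forall>\<nu>. cmod \<nu> < \<epsilon> \<longrightarrow> bergman_invertible \<alpha> (\<lambda>f z. T f z - \<nu> * f z)"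
proof -
  obtain S where T: "bergman_operator \<alpha> T" and S: "bergman_operator \<alpha> S"
    and inv: "\<And>f. f \<in> bergman_space \<alpha> \<Longrightarrow> S (T f) = f" "\<And>f. f \<in> bergman_space \<alpha> \<Longrightarrow> T (S f) = f"
    using assms by (auto simp: bergman_invertible_def)
  obtain K where K: "K \<ge> 0" "\<And>f. f \<in> bergman_space \<alpha> \<Longrightarrow> bergman_norm \<alpha> (S f) \<le> K * bergman_norm \<alpha> f"
    using bergman_operatorD(4)[OF \<alpha> S] by blast
  show ?thesis
  proof (intro exI[of _ "1 / (2 * (K + 1))"] conjI allI impI)
    show "0 < 1 / (2 * (K + 1))" using K by simp
    fix \<nu> :: complex assume \<nu>: "cmod \<nu> < 1 / (2 * (K + 1))"
    define P where "P = (\<lambda>f z. \<nu> * S f z)"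
    have P: "bergman_operator \<alpha> P"
      unfolding P_def by (rule bergman_operator_compose[OF \<alpha> bergman_operator_scale[OF \<alpha>] S])
    have "bergman_norm \<alpha> (P f) \<le> 1/2 * bergman_norm \<alpha> f" if f: "f \<in> bergman_space \<alpha>" for f
    proof -
      have "bergman_norm \<alpha> (P f) \<le> cmod \<nu> * bergman_norm \<alpha> (S f)"
        unfolding P_def by (rule bergman_scale(2)[OF \<alpha> bergman_operatorD(1)[OF \<alpha> S f]])
      also have "\<dots> \<le> cmod \<nu> * (K * bergman_norm \<alpha> f)" by (intro mult_left_mono K f) simp
      also have "\<dots> = (cmod \<nu> * K) * bergman_norm \<alpha> f" by simp
      also have "\<dots> \<le> 1/2 * bergman_norm \<alpha> f"
      proof (intro mult_right_mono bergman_norm_nonneg[OF \<alpha>])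
        have "cmod \<nu> * K \<le> 1 / (2 * (K + 1)) * K" using \<nu> K(1) by (intro mult_right_mono) auto
        also have "\<dots> \<le> 1/2" using K(1) by (simp add: field_simps)
        finally show "cmod \<nu> * K \<le> 1/2" .
      qed
      finally show ?thesis .
    qed
    then have "bergman_invertible \<alpha> (\<lambda>f z. f z - P f z)"
      by (rule bergman_small_perturbation[OF P])
    then have "bergman_invertible \<alpha> (\<lambda>f. T (\<lambda>z. f z - P f z))"
      by (rule bergman_invertible_compose[OF \<alpha> assms])
    moreover have "T (\<lambda>z. f z - P f z) = (\<lambda>z. T f z - \<nu> * f z)" if f: "f \<in> bergman_space \<alpha>" for f
    proof -
      note Sf = bergman_operatorD(1)[OF \<alpha> S f]
      have "T (\<lambda>z. f z + (- \<nu>) * S f z) = (\<lambda>z. T f z + T (\<lambda>z. (- \<nu>) * S f z) z)"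
        by (rule bergman_operatorD(2)[OF \<alpha> T f bergman_scale(1)[OF \<alpha> Sf]])
      then have "T (\<lambda>z. f z + (- \<nu>) * S f z) = (\<lambda>z. T f z + (- \<nu>) * f z)"
        by (simp only: bergman_operatorD(3)[OF \<alpha> T Sf] inv(2)[OF f])
      then show ?thesis by (simp add: P_def)
    qed
    ultimately show "bergman_invertible \<alpha> (\<lambda>f z. T f z - \<nu> * f z)"
      using bergman_invertible_cong[OF \<alpha>, of "\<lambda>f. T (\<lambda>z. f z - P f z)" "\<lambda>f z. T f z - \<nu> * f z"] by blast
  qed
qed

end

section \<open>Parabolic automorphisms as translations of a half-plane\<close>

text \<open>For \<open>a\<close> on the unit circle, maps the unit disk onto the upper half-plane and the boundary point \<open>a\<close> to infinity.\<close>

definition cayley :: "complex \<Rightarrow> complex \<Rightarrow> complex" where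
  "cayley a z = \<i> * (a + z) / (a - z)"

definition inverse_cayley :: "complex \<Rightarrow> complex \<Rightarrow> complex" where
  "inverse_cayley a w = a * (w - \<i>) / (w + \<i>)"

text \<open>The translation by \<open>s\<close> of the upper half-plane, seen in the disk.\<close>

definition parabolic_flow :: "complex \<Rightarrow> real \<Rightarrow> complex \<Rightarrow> complex" where
  "parabolic_flow a s z = inverse_cayley a (cayley a z + of_real s)"

lemma upper_half_plane_plus_i: "Im w > 0 \<Longrightarrow> w + \<i> \<noteq> 0" "Im w > 0 \<Longrightarrow> 1 \<le> cmod (w + \<i>)"
proof -
  assume "Im w > 0"
  then have "1 \<le> cmod (w + \<i>)" using abs_Im_le_cmod[of "w + \<i>"] by simp
  then show "1 \<le> cmod (w + \<i>)" "w + \<i> \<noteq> 0" by auto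
qed

context
  fixes a :: complex assumes a: "cmod a = 1"
begin

lemma disk_neq_boundary: "z \<in> unit_disk \<Longrightarrow> a - z \<noteq> 0"
  using a by auto

lemma cayley_plus_i: "z \<in> unit_disk \<Longrightarrow> cayley a z + \<i> = 2 * \<i> * a / (a - z)"
  using disk_neq_boundary[of z] by (simp add: cayley_def field_simps)

lemma norm_cayley_plus_i: "z \<in> unit_disk \<Longrightarrow> cmod (cayley a z + \<i>) * cmod (a - z) = 2"
  using disk_neq_boundary[of z] a by (simp add: cayley_plus_i norm_mult norm_divide)

lemma inverse_cayley_cayley: "z \<in> unit_disk \<Longrightarrow> inverse_cayley a (cayley a z) = z"
proof -
  assume z: "z \<in> unit_disk"
  have "cayley a z - \<i> = 2 * \<i> * z / (a - z)"
    using disk_neq_boundary[OF z] by (simp add: cayley_def field_simps)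
  then show ?thesis
    unfolding inverse_cayley_def cayley_plus_i[OF z]
    using disk_neq_boundary[OF z] a by (auto simp: field_simps)
qed

lemma cayley_inverse_cayley: "Im w > 0 \<Longrightarrow> cayley a (inverse_cayley a w) = w"
proof -
  assume w: "Im w > 0"
  note nz = upper_half_plane_plus_i(1)[OF w]
  have "a - inverse_cayley a w = a * (2 * \<i>) / (w + \<i>)" "a + inverse_cayley a w = a * (2 * w) / (w + \<i>)"
    using nz by (simp_all add: inverse_cayley_def field_simps)
  then show ?thesis using nz a by (auto simp: cayley_def)
qed

lemma inverse_cayley_defect:
  assumes "Im w > 0"
  shows "1 - (cmod (inverse_cayley a w))\<^sup>2 = 4 * Im w / (cmod (w + \<i>))\<^sup>2"
proof -
  have "(cmod (w + \<i>))\<^sup>2 - (cmod (w - \<i>))\<^sup>2 = 4 * Im w"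
    unfolding cmod_power2 by (simp add: power2_eq_square algebra_simps)
  moreover have "(cmod (w + \<i>))\<^sup>2 \<noteq> 0" using upper_half_plane_plus_i[OF assms] by simp
  moreover have "cmod (inverse_cayley a w) = cmod (w - \<i>) / cmod (w + \<i>)"
    using a by (simp add: inverse_cayley_def norm_mult norm_divide)
  ultimately show ?thesis by (simp add: power_divide field_simps)
qed

lemma inverse_cayley_in_disk:
  assumes "Im w > 0" shows "inverse_cayley a w \<in> unit_disk"
proof -
  have "0 < 4 * Im w / (cmod (w + \<i>))\<^sup>2" using assms upper_half_plane_plus_i[OF assms] by simp
  then have "(cmod (inverse_cayley a w))\<^sup>2 < 1" using inverse_cayley_defect[OF assms] by linarith
  then show ?thesis by (simp add: abs_square_less_1)
qed

lemma Im_cayley_pos: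
  assumes z: "z \<in> unit_disk" shows "0 < Im (cayley a z)"
proof -
  let ?w = "cayley a z"
  have nz: "?w + \<i> \<noteq> 0" using cayley_plus_i[OF z] disk_neq_boundary[OF z] a by auto
  have "cmod z = cmod (?w - \<i>) / cmod (?w + \<i>)"
    using arg_cong[OF inverse_cayley_cayley[OF z], of cmod] a by (simp add: inverse_cayley_def norm_mult norm_divide)
  then have "cmod (?w - \<i>) / cmod (?w + \<i>) < 1" using z by simp
  moreover have "0 < cmod (?w + \<i>)" using nz by simp
  ultimately have "cmod (?w - \<i>) < cmod (?w + \<i>)" by (simp only: divide_less_eq_1_pos)
  then have "(cmod (?w - \<i>))\<^sup>2 < (cmod (?w + \<i>))\<^sup>2" by (intro power_strict_mono) auto
  then show ?thesis unfolding cmod_power2 by (simp add: power2_eq_square algebra_simps)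
qed

lemma Im_cayley_shift: "z \<in> unit_disk \<Longrightarrow> 0 < Im (cayley a z + of_real s)"
  using Im_cayley_pos by simp

lemma parabolic_flow_in_disk: "z \<in> unit_disk \<Longrightarrow> parabolic_flow a s z \<in> unit_disk"
  unfolding parabolic_flow_def by (intro inverse_cayley_in_disk Im_cayley_shift)

lemma cayley_flow: "z \<in> unit_disk \<Longrightarrow> cayley a (parabolic_flow a s z) = cayley a z + of_real s"
  unfolding parabolic_flow_def by (intro cayley_inverse_cayley Im_cayley_shift)

lemma parabolic_flow_add:
  "z \<in> unit_disk \<Longrightarrow> parabolic_flow a s (parabolic_flow a r z) = parabolic_flow a (r + s) z"
  by (subst parabolic_flow_def) (simp add: cayley_flow, simp add: parabolic_flow_def add.assoc)

lemma parabolic_flow_0: "z \<in> unit_disk \<Longrightarrow> parabolic_flow a 0 z = z"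
  by (simp add: parabolic_flow_def inverse_cayley_cayley)

lemma parabolic_flow_image: "parabolic_flow a s ` unit_disk = unit_disk"
proof -
  have "z \<in> parabolic_flow a s ` unit_disk" if "z \<in> unit_disk" for z
    using that parabolic_flow_add[OF that, of s "-s"] parabolic_flow_0 parabolic_flow_in_disk[of z "-s"]
    by (metis add.left_inverse imageI)
  then show ?thesis using parabolic_flow_in_disk by auto
qed

lemma inj_parabolic_flow: "inj_on (parabolic_flow a s) unit_disk"
  using parabolic_flow_add[of _ "-s" s] parabolic_flow_0 by (metis add.right_inverse inj_onI)

text \<open>By the Schwarz-Pick identity this is both the modulus of the derivative of the flow and the
  factor by which the flow changes \<open>1 - \<bar>z\<bar>\<^sup>2\<close>.\<close>

definition flow_ratio :: "real \<Rightarrow> complex \<Rightarrow> real" where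
  "flow_ratio s z = (cmod (cayley a z + \<i>) / cmod (cayley a z + of_real s + \<i>))\<^sup>2"

text \<open>Translation by \<open>s\<close> changes the distance to \<open>-\<i>\<close> by at most \<open>\<bar>s\<bar>\<close>, and that distance is at
  least 1 on the half-plane. This is the source of the polynomial norm growth.\<close>

lemma flow_ratio_ge:
  assumes z: "z \<in> unit_disk" shows "1 / (1 + \<bar>s\<bar>)\<^sup>2 \<le> flow_ratio s z"
proof -
  let ?w = "cayley a z"
  have 1: "1 \<le> cmod (?w + \<i>)" using upper_half_plane_plus_i(2)[OF Im_cayley_pos[OF z]] .
  have 2: "1 \<le> cmod (?w + of_real s + \<i>)" using upper_half_plane_plus_i(2)[OF Im_cayley_shift[OF z]] .
  have "cmod (?w + of_real s + \<i>) \<le> cmod (?w + \<i>) + \<bar>s\<bar>"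
    using norm_triangle_ineq[of "?w + \<i>" "of_real s"] by (simp add: algebra_simps)
  also have "\<dots> \<le> cmod (?w + \<i>) * (1 + \<bar>s\<bar>)"
    using mult_right_mono[OF 1, of "\<bar>s\<bar>"] by (simp add: algebra_simps)
  finally have "1 / (1 + \<bar>s\<bar>) \<le> cmod (?w + \<i>) / cmod (?w + of_real s + \<i>)"
    using upper_half_plane_plus_i(1)[OF Im_cayley_shift[OF z]] by (auto simp: divide_simps mult.commute)
  then have "(1 / (1 + \<bar>s\<bar>))\<^sup>2 \<le> (cmod (?w + \<i>) / cmod (?w + of_real s + \<i>))\<^sup>2"
    by (rule power_mono) simp
  then show ?thesis by (simp add: flow_ratio_def power_divide)
qed

lemma parabolic_flow_defect:
  assumes z: "z \<in> unit_disk"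
  shows "1 - (cmod (parabolic_flow a s z))\<^sup>2 = flow_ratio s z * (1 - (cmod z)\<^sup>2)"
proof -
  have "1 - (cmod (parabolic_flow a s z))\<^sup>2 = 4 * Im (cayley a z) / (cmod (cayley a z + of_real s + \<i>))\<^sup>2"
    unfolding parabolic_flow_def by (subst inverse_cayley_defect[OF Im_cayley_shift[OF z]]) simp
  moreover have "1 - (cmod z)\<^sup>2 = 4 * Im (cayley a z) / (cmod (cayley a z + \<i>))\<^sup>2"
    using inverse_cayley_defect[OF Im_cayley_pos[OF z]] by (simp add: inverse_cayley_cayley[OF z])
  ultimately show ?thesis
    using upper_half_plane_plus_i(2)[OF Im_cayley_pos[OF z]] by (auto simp: flow_ratio_def power_divide)
qed

lemma parabolic_flow_has_derivative:
  assumes z: "z \<in> unit_disk"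
  shows "\<exists>D. (parabolic_flow a s has_field_derivative D) (at z) \<and> cmod D = flow_ratio s z"
proof -
  let ?w = "cayley a z + of_real s"
  have nz: "?w + \<i> \<noteq> 0" "a - z \<noteq> 0"
    using upper_half_plane_plus_i(1)[OF Im_cayley_shift[OF z]] disk_neq_boundary[OF z] by auto
  have d1: "((\<lambda>z. cayley a z + of_real s) has_field_derivative (2 * \<i> * a / (a - z)\<^sup>2)) (at z)"
    unfolding cayley_def using nz
    by (auto intro!: derivative_eq_intros simp: field_simps power2_eq_square)
  have d2: "(inverse_cayley a has_field_derivative (2 * \<i> * a / (?w + \<i>)\<^sup>2)) (at ?w)"
    unfolding inverse_cayley_def using nz
    by (auto intro!: derivative_eq_intros simp: field_simps power2_eq_square)
  have d: "(parabolic_flow a s has_field_derivative (2 * \<i> * a / (?w + \<i>)\<^sup>2) * (2 * \<i> * a / (a - z)\<^sup>2)) (at z)"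
    using DERIV_chain[OF d2 d1] by (simp add: parabolic_flow_def[abs_def] o_def)
  have "cmod ((2 * \<i> * a / (?w + \<i>)\<^sup>2) * (2 * \<i> * a / (a - z)\<^sup>2)) = (2 / cmod (a - z))\<^sup>2 / (cmod (?w + \<i>))\<^sup>2"
    using a by (simp add: norm_mult norm_divide norm_power power_divide)
  also have "2 / cmod (a - z) = cmod (cayley a z + \<i>)"
    using norm_cayley_plus_i[OF z] nz by (simp add: field_simps)
  finally show ?thesis using d by (auto simp: flow_ratio_def power_divide)
qed

lemma holomorphic_parabolic_flow: "parabolic_flow a s holomorphic_on unit_disk"
  using parabolic_flow_has_derivative holomorphic_on_open by (metis open_ball)

lemma norm_deriv_parabolic_flow: "z \<in> unit_disk \<Longrightarrow> cmod (deriv (parabolic_flow a s) z) = flow_ratio s z"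
  using parabolic_flow_has_derivative DERIV_imp_deriv by metis

lemma holomorphic_cayley: "cayley a holomorphic_on unit_disk"
  unfolding cayley_def using disk_neq_boundary by (intro holomorphic_intros) auto

end

text \<open>After moving the zero of the automorphism to the origin, the Schwarz lemma applies to the
  resulting map and to its inverse, so the derivative at 0 has modulus 1 and the map is a rotation.\<close>

lemma disk_automorphism_moebius:
  assumes "disk_automorphism \<phi>"
  obtains e b where "cmod e = 1" "b \<in> unit_disk"
    "\<And>z. z \<in> unit_disk \<Longrightarrow> \<phi> z = e * (z - b) / (1 - cnj b * z)"
proof -
  have hol: "\<phi> holomorphic_on unit_disk" and bij: "bij_betw \<phi> unit_disk unit_disk"
    using assms by (auto simp: disk_automorphism_def)
  obtain b where b: "b \<in> unit_disk" "\<phi> b = 0"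
    using bij unfolding bij_betw_def by (metis centre_in_ball imageE zero_less_one)
  define M where "M = Moebius_function 0 (-b)"
  define N where "N = Moebius_function 0 b"
  have MN: "M z \<in> unit_disk" "N z \<in> unit_disk" "M (N z) = z" "N (M z) = z" if "z \<in> unit_disk" for z
    using that b Moebius_function_norm_lt_1[of "-b" z 0] Moebius_function_norm_lt_1[of b z 0]
      Moebius_function_compose[of b "-b" z] Moebius_function_compose[of "-b" b z]
    by (auto simp: M_def N_def)
  have hM: "M holomorphic_on unit_disk" using b Moebius_function_holomorphic[of "-b" 0] by (simp add: M_def)
  define g where "g = \<phi> \<circ> M"
  have Mim: "M ` unit_disk = unit_disk" using MN by (metis image_eqI image_subsetI subsetI subset_antisym)
  have hg: "g holomorphic_on unit_disk"
    unfolding g_def by (intro holomorphic_on_compose hM) (simp add: Mim hol)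
  have gim: "g ` unit_disk = unit_disk"
    using bij unfolding g_def image_comp[symmetric] Mim by (simp add: bij_betw_def)
  have ginj: "inj_on g unit_disk"
    unfolding g_def using bij MN by (intro comp_inj_on) (auto simp: Mim bij_betw_def intro: inj_on_inverseI[where g=N])
  have g0: "g 0 = 0" using b by (simp add: g_def M_def Moebius_function_simple)
  obtain h where h: "h holomorphic_on g ` unit_disk"
    "\<And>z. z \<in> unit_disk \<Longrightarrow> deriv g z * deriv h (g z) = 1" "\<And>z. z \<in> unit_disk \<Longrightarrow> h (g z) = z"
    using holomorphic_has_inverse[OF hg open_ball ginj] by metis
  have h0: "h 0 = 0" using h(3)[of 0] g0 by simp
  have hn: "cmod (h z) < 1" if "cmod z < 1" for z
  proof -
    have "z \<in> g ` unit_disk" using that gim by auto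
    then show ?thesis using h(3) by auto
  qed
  have gn: "cmod (g z) < 1" if "cmod z < 1" for z
    using that gim by (metis imageI mem_ball_0)
  have dh: "cmod (deriv h 0) \<le> 1"
    using Schwarz_Lemma(2)[of h 0] h(1) gim h0 hn by auto
  have dg: "cmod (deriv g 0) \<le> 1"
    using Schwarz_Lemma(2)[of g 0] hg g0 gn by auto
  have "cmod (deriv g 0) * cmod (deriv h 0) = 1"
    using h(2)[of 0] g0 by (metis centre_in_ball norm_mult norm_one zero_less_one)
  then have "cmod (deriv g 0) = 1"
    using dh dg mult_left_le[OF dh, of "cmod (deriv g 0)"] by auto
  then obtain e where e: "\<And>z. cmod z < 1 \<Longrightarrow> g z = e * z" "cmod e = 1"
    using Schwarz_Lemma(3)[of g 0] hg g0 gn by auto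
  show ?thesis
  proof
    show "cmod e = 1" "b \<in> unit_disk" using e b by auto
    fix z assume z: "z \<in> unit_disk"
    have "\<phi> z = g (N z)" using MN[OF z] by (simp add: g_def)
    also have "\<dots> = e * N z" using MN[OF z] e by simp
    finally show "\<phi> z = e * (z - b) / (1 - cnj b * z)"
      by (simp add: N_def Moebius_function_simple)
  qed
qed

text \<open>The fixed points of \<open>z \<mapsto> e (z - b) / (1 - cnj b z)\<close> are the roots of a quadratic polynomial
  whose roots have a product of modulus 1. The Denjoy-Wolff point \<open>a\<close> is a root, so the other root is
  on the unit circle too, and by uniqueness it is \<open>a\<close> again. A double root at \<open>a\<close> determines \<open>e\<close>
  in terms of \<open>b\<close>, and in the coordinate \<open>cayley a\<close> the map becomes a translation.\<close>

theorem parabolic_automorphism_is_flow: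
  assumes par: "parabolic_automorphism \<phi>" and a: "cmod a = 1" and dw: "denjoy_wolff_point \<phi> a"
  obtains t where "t \<noteq> 0" "\<And>z. z \<in> unit_disk \<Longrightarrow> \<phi> z = parabolic_flow a t z"
proof -
  have aut: "disk_automorphism \<phi>" and nofix: "\<And>z. z \<in> unit_disk \<Longrightarrow> \<phi> z \<noteq> z"
    and uniq: "\<exists>!c. boundary_fixed_point \<phi> c"
    using par by (auto simp: parabolic_automorphism_def)
  obtain e b where e: "cmod e = 1" and b: "b \<in> unit_disk"
    and \<phi>: "\<And>z. z \<in> unit_disk \<Longrightarrow> \<phi> z = e * (z - b) / (1 - cnj b * z)"
    using disk_automorphism_moebius[OF aut] by metis
  have e0: "e \<noteq> 0" using e by auto
  have a0: "a \<noteq> 0" using a by auto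
  define m where "m = (\<lambda>z. e * (z - b) / (1 - cnj b * z))"
  have den: "1 - cnj b * c \<noteq> 0" if "cmod c \<le> 1" for c
  proof
    assume "1 - cnj b * c = 0"
    then have "cmod (cnj b * c) = 1" by (metis eq_iff_diff_eq_0 norm_one)
    moreover have "cmod b * cmod c \<le> cmod b * 1" using that by (intro mult_left_mono) auto
    ultimately show False using b by (simp add: norm_mult)
  qed
  have cm: "isCont m c" if "cmod c \<le> 1" for c
    unfolding m_def using den[OF that] by (intro continuous_intros) auto
  have bfp: "boundary_fixed_point \<phi> c" if c: "cmod c = 1" "m c = c" for c
  proof -
    have "(m \<longlongrightarrow> m c) (at c within unit_disk)"
      using cm[of c] c by (simp add: isCont_def tendsto_within_subset[OF _ subset_UNIV])
    moreover have "eventually (\<lambda>z. m z = \<phi> z) (at c within unit_disk)"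
      using \<phi> by (auto simp: m_def eventually_at_filter)
    ultimately show ?thesis
      using c by (auto simp: boundary_fixed_point_def intro: Lim_transform_eventually)
  qed
  have orbit: "(\<phi> ^^ n) 0 \<in> unit_disk" for n
  proof (induction n)
    case (Suc n)
    then show ?case using aut by (auto simp: disk_automorphism_def bij_betw_def)
  qed simp
  have lim: "(\<lambda>n. (\<phi> ^^ n) 0) \<longlonglongrightarrow> a"
  proof -
    have "uniform_limit {0} (\<lambda>n. \<phi> ^^ n) (\<lambda>_. a) sequentially"
      using dw[unfolded denjoy_wolff_point_def, rule_format, of "{0}"] by simp
    then show ?thesis by (rule tendsto_uniform_limitI) simp
  qed
  have "(\<lambda>n. m ((\<phi> ^^ n) 0)) \<longlonglongrightarrow> m a"
    using a by (intro isCont_tendsto_compose[OF cm lim]) simp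
  moreover have "m ((\<phi> ^^ n) 0) = (\<phi> ^^ Suc n) 0" for n
    using \<phi>[OF orbit[of n]] by (simp add: m_def)
  moreover have "(\<lambda>n. (\<phi> ^^ Suc n) 0) \<longlonglongrightarrow> a" using LIMSEQ_Suc[OF lim] .
  ultimately have ma: "m a = a" by (simp add: LIMSEQ_unique)
  then have q: "cnj b * a\<^sup>2 + (e - 1) * a - e * b = 0"
    using den[of a] a by (simp add: m_def field_simps power2_eq_square)
  have b0: "b \<noteq> 0"
  proof
    assume "b = 0"
    then have "\<phi> 0 = 0" using \<phi>[of 0] by simp
    then show False using nofix[of 0] by simp
  qed
  \<comment> \<open>the second root, from the product of the roots\<close>
  define c where "c = - (e * b / (cnj b * a))"
  have c1: "cmod c = 1" using e a b0 by (simp add: c_def norm_mult norm_divide)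
  have cba: "cnj b * a * c = - (e * b)" using a0 b0 by (simp add: c_def)
  have q': "(e - 1) * a = e * b - cnj b * a\<^sup>2" using q by (simp add: algebra_simps)
  have "(cnj b * c\<^sup>2 + (e - 1) * c - e * b) * a = 0"
  proof -
    have "(cnj b * c\<^sup>2 + (e - 1) * c - e * b) * a = (cnj b * a * c) * c + ((e - 1) * a) * c - e * b * a"
      by (simp add: algebra_simps power2_eq_square)
    also have "\<dots> = - (e * b) * c + (e * b - cnj b * a\<^sup>2) * c - e * b * a"
      by (simp only: cba q')
    also have "\<dots> = - (cnj b * a * c) * a - e * b * a" by (simp add: algebra_simps power2_eq_square)
    finally show ?thesis unfolding cba by simp
  qed
  then have "cnj b * c\<^sup>2 + (e - 1) * c - e * b = 0" using a0 by simp
  then have "m c = c" using den[of c] c1 by (simp add: m_def field_simps power2_eq_square)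
  then have ca: "c = a" using uniq bfp[OF c1] bfp[OF a ma] by auto
  define x where "x = a * cnj b"
  have eb: "e * b = - (a * x)" using cba by (simp add: ca x_def algebra_simps)
  have "(e - 1 + 2 * x) * a = 0" using q eb by (simp add: x_def algebra_simps power2_eq_square)
  then have "e - 1 + 2 * x = 0" using a0 by simp
  then have ex: "e = 1 - 2 * x" by (simp add: algebra_simps)
  have x1: "1 - x \<noteq> 0" using den[of a] a by (simp add: x_def mult.commute)
  have cb: "cnj b = x / a" using a0 by (simp add: x_def)
  \<comment> \<open>\<open>2 \<i> x / (1 - x)\<close>, which is real because \<open>1 - 2 x\<close> has modulus 1\<close>
  define t where "t = - 2 * Im x / (cmod (1 - x))\<^sup>2"
  have t: "complex_of_real t = 2 * \<i> * x / (1 - x)"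
  proof -
    have "(cmod e)\<^sup>2 = 1" using e by simp
    then have xx: "(Re x)\<^sup>2 + (Im x)\<^sup>2 = Re x"
      unfolding ex by (simp add: cmod_power2) (simp add: power2_eq_square algebra_simps)
    have "2 * \<i> * x / (1 - x) = 2 * \<i> * (x * cnj (1 - x)) / of_real ((cmod (1 - x))\<^sup>2)"
    proof -
      have n: "complex_of_real ((cmod (1 - x))\<^sup>2) = (1 - x) * cnj (1 - x)" by (rule complex_norm_square)
      have "cnj (1 - x) \<noteq> 0" using x1 by (simp only: complex_cnj_zero_iff not_False_eq_True)
      from mult_divide_mult_cancel_right[OF this, of "2 * \<i> * x" "1 - x"] show ?thesis
        unfolding n by (simp only: mult.assoc)
    qed
    also have "x * cnj (1 - x) = \<i> * of_real (Im x)"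
      using xx by (simp add: complex_eq_iff power2_eq_square algebra_simps)
    also have "2 * \<i> * (\<i> * complex_of_real (Im x)) = - (2 * of_real (Im x))" by (simp add: complex_eq_iff)
    finally show ?thesis by (simp add: t_def)
  qed
  have flow: "\<phi> z = parabolic_flow a t z" if z: "z \<in> unit_disk" for z
  proof -
    have az: "a - z \<noteq> 0" using disk_neq_boundary[OF a z] .
    have "1 - cnj b * z \<noteq> 0" using den[of z] z by simp
    then have xz: "a - x * z \<noteq> 0" using a0 by (simp add: cb field_simps)
    have z': "\<phi> z = a * ((1 - 2 * x) * z + a * x) / (a - x * z)"
    proof -
      have num: "e * z - e * b = (1 - 2 * x) * z + a * x" unfolding eb by (simp add: ex)
      have "\<phi> z = (e * z - e * b) / (1 - cnj b * z)" using \<phi>[OF z] by (simp add: algebra_simps)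
      also have "\<dots> = ((1 - 2 * x) * z + a * x) / (1 - x / a * z)" unfolding num cb ..
      also have "1 - x / a * z = (a - x * z) / a" using a0 by (simp add: field_simps)
      finally show ?thesis by (simp add: mult.commute)
    qed
    have m1: "a - \<phi> z = a * (1 - x) * (a - z) / (a - x * z)"
      unfolding z' using xz by (simp add: field_simps)
    have m2: "a + \<phi> z = a * (a * (1 + x) + z * (1 - 3 * x)) / (a - x * z)"
      unfolding z' using xz by (simp add: field_simps)
    have "cayley a (\<phi> z) = \<i> * (a * (1 + x) + z * (1 - 3 * x)) / ((1 - x) * (a - z))"
      unfolding cayley_def m1 m2 using xz a0 by simp
    also have "\<dots> = cayley a z + of_real t"
      unfolding t cayley_def using x1 az by (simp add: divide_simps) (simp add: algebra_simps)
    finally have "cayley a (\<phi> z) = cayley a z + of_real t" .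
    moreover have "\<phi> z \<in> unit_disk" using aut z by (auto simp: disk_automorphism_def bij_betw_def)
    ultimately show ?thesis
      using inverse_cayley_cayley[OF a, of "\<phi> z"] by (simp add: parabolic_flow_def)
  qed
  have "t \<noteq> 0" using flow[of 0] nofix[of 0] parabolic_flow_0[OF a, of 0] by auto
  with flow show ?thesis using that by blast
qed

section \<open>Composition with a parabolic flow\<close>

context
  fixes \<alpha> :: real assumes \<alpha>: "\<alpha> > -1"
begin

text \<open>With \<open>u = 1 - \<bar>z\<bar>\<^sup>2\<close> the set where \<open>u \<le> 2\<^sup>-\<^sup>n\<close> has area \<open>\<pi> 2\<^sup>-\<^sup>n\<close>. The weight, at most a multiple of
  \<open>u powr (- \<beta>)\<close> with \<open>\<beta> < 1\<close>, is dominated by a sum of multiples of the indicators of these sets,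
  and the integrals form a convergent geometric series.\<close>

lemma disk_weight_energy_finite:
  "(\<integral>\<^sup>+z\<in>unit_disk. ennreal (disk_weight \<alpha> z) \<partial>lborel) < \<infinity>"
proof -
  define \<beta> where "\<beta> = max 0 (- \<alpha>)"
  have \<beta>: "0 \<le> \<beta>" "\<beta> < 1" "- \<beta> \<le> \<alpha>" using \<alpha> by (auto simp: \<beta>_def)
  define c where "c = (\<lambda>n::nat. (1 + \<alpha>) / pi * 2 powr (\<beta> * real (Suc n)))"
  have c: "0 \<le> c n" for n using \<alpha> by (simp add: c_def)
  define A where "A = (\<lambda>n::nat. ball (0::complex) 1 - ball 0 (sqrt (1 - (1/2) ^ n)))"
  have pow1: "(1/2::real) ^ n \<le> 1" for n by (simp add: power_le_one)
  have eA: "emeasure lborel (A n) = ennreal (pi * (1/2) ^ n)" for n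
  proof -
    have "emeasure lborel (A n) = emeasure lborel (ball (0::complex) 1) - emeasure lborel (ball (0::complex) (sqrt (1 - (1/2) ^ n)))"
      unfolding A_def using pow1[of n] by (intro emeasure_Diff) (auto simp: emeasure_ball intro!: subset_ball)
    also have "\<dots> = ennreal pi - ennreal (pi * (1 - (1/2) ^ n))"
      using pow1[of n] by (simp add: emeasure_ball unit_ball_vol_2)
    also have "\<dots> = ennreal (pi * (1/2) ^ n)"
      using pow1[of n] by (subst ennreal_minus) (auto simp: algebra_simps)
    finally show ?thesis .
  qed
  have "(\<integral>\<^sup>+z\<in>unit_disk. ennreal (disk_weight \<alpha> z) \<partial>lborel) \<le>
      (\<integral>\<^sup>+z. (\<Sum>n. ennreal (c n) * indicator (A n) z) \<partial>lborel)"
  proof (rule nn_integral_mono)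
    fix z
    show "ennreal (disk_weight \<alpha> z) * indicator unit_disk z \<le> (\<Sum>n. ennreal (c n) * indicator (A n) z)"
    proof (cases "z \<in> unit_disk")
      case True
      define u where "u = 1 - (cmod z)\<^sup>2"
      have u: "0 < u" "u \<le> 1" using unit_disk_defect_pos[OF True] by (auto simp: u_def)
      obtain N where N: "(1/2::real) ^ N < u" using real_arch_pow_inv[OF u(1), of "1/2"] by auto
      define n where "n = (LEAST n. (1/2::real) ^ Suc n < u)"
      have "(1/2::real) ^ Suc N < u" using N u(1) by simp
      then have n1: "(1/2::real) ^ Suc n < u" unfolding n_def by (rule LeastI)
      have n2: "u \<le> (1/2) ^ n"
      proof (cases n)
        case 0 then show ?thesis using u by simp
      next
        case (Suc k)
        then have "\<not> (1/2::real) ^ Suc k < u" unfolding n_def using not_less_Least by (metis lessI)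
        then show ?thesis using Suc by simp
      qed
      have "u powr \<alpha> \<le> u powr (- \<beta>)" using u \<beta>(3) by (intro powr_mono') auto
      also have "\<dots> \<le> ((1/2) ^ Suc n) powr (- \<beta>)"
        using n1 \<beta> by (intro powr_mono2') auto
      also have "((1/2::real) ^ Suc n) powr (- \<beta>) = 2 powr (\<beta> * real (Suc n))"
      proof -
        have "(1/2::real) ^ Suc n = 2 powr (- real (Suc n))"
          by (simp only: powr_minus powr_realpow zero_less_numeral) (simp add: power_one_over inverse_eq_divide)
        then show ?thesis by (simp only: powr_powr minus_mult_minus mult.commute)
      qed
      finally have "disk_weight \<alpha> z \<le> c n"
        using \<alpha> by (auto simp: disk_weight_def c_def u_def intro!: mult_left_mono divide_right_mono)
      moreover have "z \<in> A n"
      proof -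
        have "1 - (1/2)^n \<le> (cmod z)\<^sup>2" using n2 by (simp add: u_def)
        then have "sqrt (1 - (1/2)^n) \<le> cmod z" by (metis real_sqrt_le_mono norm_ge_zero real_sqrt_abs abs_norm_cancel)
        then show ?thesis using True by (simp add: A_def)
      qed
      moreover have single: "g n \<le> suminf g" for g :: "nat \<Rightarrow> ennreal"
        using sum_le_suminf[of g "{n}"] by simp
      ultimately have "ennreal (disk_weight \<alpha> z) * indicator unit_disk z \<le> ennreal (c n) * indicator (A n) z"
        using True by (simp add: ennreal_leI)
      also have "\<dots> \<le> (\<Sum>n. ennreal (c n) * indicator (A n) z)" by (rule single)
      finally show ?thesis .
    qed simp
  qed
  also have "\<dots> = (\<Sum>n. ennreal (c n) * emeasure lborel (A n))"
  proof -
    have mA[measurable]: "A n \<in> sets borel" for n unfolding A_def by (intro sets.Diff borel_open open_ball)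
    have "(\<integral>\<^sup>+z. (\<Sum>n. ennreal (c n) * indicator (A n) z) \<partial>lborel) =
        (\<Sum>n. \<integral>\<^sup>+z. ennreal (c n) * indicator (A n) z \<partial>lborel)"
      by (intro nn_integral_suminf) measurable
    then show ?thesis using mA by (simp add: nn_integral_cmult_indicator)
  qed
  also have "\<dots> = (\<Sum>n. ennreal (c n * (pi * (1/2) ^ n)))"
    using c by (simp add: eA ennreal_mult)
  also have "\<dots> < \<infinity>"
  proof -
    have eq: "c n * (pi * (1/2) ^ n) = ((1 + \<alpha>) * 2 powr \<beta>) * (2 powr (\<beta> - 1)) ^ n" for n
    proof -
      have "(2 powr (\<beta> - 1)) ^ n = 2 powr (\<beta> * real n) * (1/2::real) ^ n"
        by (simp add: powr_diff power_divide powr_power mult.commute power_one_over)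
      moreover have "2 powr (\<beta> * real (Suc n)) = 2 powr \<beta> * 2 powr (\<beta> * real n)"
        by (simp add: powr_add[symmetric] algebra_simps)
      ultimately show ?thesis by (simp add: c_def)
    qed
    have "2 powr (\<beta> - 1) < (2::real) powr 0" using \<beta> by (intro powr_less_mono) auto
    then have "summable (\<lambda>n. c n * (pi * (1/2) ^ n))"
      unfolding eq by (intro summable_mult summable_geometric) simp
    then have "(\<Sum>n. ennreal (c n * (pi * (1/2) ^ n))) \<noteq> top"
      using c by (intro ennreal_suminf_neq_top) auto
    then show ?thesis by (simp add: less_top)
  qed
  finally show ?thesis .
qed

text \<open>The source of nonzero elements: it shows that point evaluations do not vanish identically.\<close>

lemma bergman_indicator_disk: "(\<lambda>z. if z \<in> unit_disk then 1 else 0) \<in> bergman_space \<alpha>"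
proof -
  let ?f = "\<lambda>z. if z \<in> unit_disk then 1 else (0::complex)"
  have h: "?f holomorphic_on unit_disk" by (rule holomorphic_transform[OF holomorphic_on_const[of 1]]) auto
  have "bergman_energy \<alpha> ?f = (\<integral>\<^sup>+z\<in>unit_disk. ennreal (disk_weight \<alpha> z) \<partial>lborel)"
    unfolding bergman_energy_def by (intro nn_integral_cong) (auto simp: bergman_density_weight indicator_def)
  then have "bergman_energy \<alpha> ?f < top" using disk_weight_energy_finite by simp
  then obtain r where r: "0 \<le> r" "bergman_energy \<alpha> ?f = ennreal r" by (cases "bergman_energy \<alpha> ?f") auto
  then have "bergman_energy \<alpha> ?f \<le> ennreal ((sqrt r)\<^sup>2)" by simp
  from bergman_spaceI(1)[OF \<alpha> h _ this] show ?thesis using r by simp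
qed

text \<open>A function of norm at most 1 whose value at \<open>z\<close> is at least half of the norm of the point
  evaluation at \<open>z\<close>. It serves as a substitute for the normalized reproducing kernel.\<close>

lemma bergman_near_extremal:
  assumes z: "z \<in> unit_disk"
  obtains g where "g \<in> bergman_space \<alpha>" "bergman_norm \<alpha> g \<le> 1" "g z \<noteq> 0"
    "\<And>f. f \<in> bergman_space \<alpha> \<Longrightarrow> cmod (f z) \<le> 2 * cmod (g z) * bergman_norm \<alpha> f"
proof -
  obtain C where C: "0 \<le> C" "\<And>f. f \<in> bergman_space \<alpha> \<Longrightarrow> cmod (f z) \<le> C * bergman_norm \<alpha> f"
    using z bergman_point_evaluation[OF \<alpha>, of "cmod z"] by (metis mem_ball_0 norm_ge_zero order_refl)
  define V where "V = {cmod (f z) |f. f \<in> bergman_space \<alpha> \<and> bergman_norm \<alpha> f \<le> 1}"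
  have bd: "bdd_above V"
  proof (rule bdd_aboveI)
    fix x assume "x \<in> V"
    then obtain f where f: "x = cmod (f z)" "f \<in> bergman_space \<alpha>" "bergman_norm \<alpha> f \<le> 1" by (auto simp: V_def)
    then show "x \<le> C" using C(2)[OF f(2)] mult_left_mono[OF f(3) C(1)] by simp
  qed
  have scaled: "cmod (f z) \<le> Sup V * bergman_norm \<alpha> f" if f: "f \<in> bergman_space \<alpha>" for f
  proof (cases "bergman_norm \<alpha> f = 0")
    case True
    then show ?thesis using C(2)[OF f] by simp
  next
    case False
    then have p: "0 < bergman_norm \<alpha> f" using bergman_norm_nonneg[OF \<alpha>, of f] by simp
    let ?c = "complex_of_real (1 / bergman_norm \<alpha> f)"
    have "cmod (?c * f z) \<in> V"
      unfolding V_def using bergman_scale[OF \<alpha> f, of ?c] p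
      by (intro CollectI exI[of _ "\<lambda>z. ?c * f z"]) (auto simp: norm_divide)
    then have "cmod (?c * f z) \<le> Sup V" using bd by (intro cSup_upper) auto
    then show ?thesis using p by (simp add: norm_mult norm_divide field_simps)
  qed
  have pos: "0 < Sup V"
  proof -
    have "0 < Sup V * bergman_norm \<alpha> (\<lambda>z. if z \<in> unit_disk then 1 else 0)"
      using scaled[OF bergman_indicator_disk] z by simp
    then show ?thesis using bergman_norm_nonneg[OF \<alpha>] by (metis mult_nonpos_nonneg not_less)
  qed
  have "V \<noteq> {}"
  proof -
    have "0 \<in> V" unfolding V_def
      using bergman_scale[OF \<alpha> bergman_indicator_disk, of 0] by (intro CollectI exI[of _ "\<lambda>z. 0"]) auto
    then show ?thesis by auto
  qed
  moreover have "Sup V / 2 < Sup V" using pos by simp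
  ultimately obtain v where v: "v \<in> V" "Sup V / 2 < v" using less_cSup_iff[OF _ bd] by metis
  then obtain g where g: "v = cmod (g z)" "g \<in> bergman_space \<alpha>" "bergman_norm \<alpha> g \<le> 1" by (auto simp: V_def)
  show ?thesis
  proof
    show "g \<in> bergman_space \<alpha>" "bergman_norm \<alpha> g \<le> 1" by fact+
    show "g z \<noteq> 0" using g v pos by auto
    fix f assume f: "f \<in> bergman_space \<alpha>"
    have "Sup V \<le> 2 * cmod (g z)" using v g by simp
    then show "cmod (f z) \<le> 2 * cmod (g z) * bergman_norm \<alpha> f"
      using scaled[OF f] mult_right_mono[OF _ bergman_norm_nonneg[OF \<alpha>], of "Sup V" "2 * cmod (g z)" f] by simp
  qed
qed

text \<open>The change of variables along the flow costs two powers of \<open>flow_ratio\<close> from the Jacobian and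
  \<open>\<alpha>\<close> powers from the weight. As \<open>\<alpha> + 2 > 0\<close>, the lower bound for \<open>flow_ratio\<close> is enough.\<close>

lemma bergman_flow_composition:
  fixes s :: real
  assumes a: "cmod a = 1" and f: "f \<in> bergman_space \<alpha>"
  defines "h \<equiv> weighted_composition (\<lambda>_. 1) (parabolic_flow a s) f"
  shows "h \<in> bergman_space \<alpha>" "bergman_norm \<alpha> h \<le> (1 + \<bar>s\<bar>) powr (\<alpha> + 2) * bergman_norm \<alpha> f"
proof -
  let ?\<tau> = "parabolic_flow a s"
  define M where "M = (1 + \<bar>s\<bar>) powr (\<alpha> + 2)"
  have M: "0 < M" by (simp add: M_def add_pos_nonneg)
  have h: "h z = f (?\<tau> z)" if "z \<in> unit_disk" for z
    using that by (simp add: h_def weighted_composition_def)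
  have hh: "h holomorphic_on unit_disk"
  proof (rule holomorphic_transform)
    show "f \<circ> ?\<tau> holomorphic_on unit_disk"
      by (intro holomorphic_on_compose holomorphic_parabolic_flow[OF a])
        (simp add: parabolic_flow_image[OF a] bergman_spaceD(1)[OF \<alpha> f])
  qed (simp add: h)
  have h0: "h z = 0" if "z \<notin> unit_disk" for z using that by (simp add: h_def weighted_composition_def)
  have pt: "bergman_density \<alpha> h z \<le> M\<^sup>2 * ((cmod (deriv ?\<tau> z))\<^sup>2 * bergman_density \<alpha> f (?\<tau> z))"
    if z: "z \<in> unit_disk" for z
  proof -
    let ?r = "flow_ratio a s z"
    have lb: "1 / (1 + \<bar>s\<bar>)\<^sup>2 \<le> ?r" using flow_ratio_ge[OF a z] .
    have r: "0 < ?r" using less_le_trans[OF _ lb] by (simp add: add_pos_nonneg)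
    have wt: "disk_weight \<alpha> (?\<tau> z) = ?r powr \<alpha> * disk_weight \<alpha> z"
      unfolding disk_weight_def parabolic_flow_defect[OF a z]
      using r unit_disk_defect_pos[OF z] by (simp add: powr_mult)
    have "1 = M\<^sup>2 * (1 / (1 + \<bar>s\<bar>)\<^sup>2) powr (\<alpha> + 2)"
    proof -
      have "(1 + \<bar>s\<bar>)\<^sup>2 powr (\<alpha> + 2) = M\<^sup>2"
        unfolding M_def by (simp add: power2_eq_square powr_mult)
      then show ?thesis using M by (simp add: powr_divide)
    qed
    also have "\<dots> \<le> M\<^sup>2 * ?r powr (\<alpha> + 2)"
      using lb \<alpha> by (intro mult_left_mono powr_mono2) auto
    also have "?r powr (\<alpha> + 2) = ?r\<^sup>2 * ?r powr \<alpha>" using r by (simp add: powr_add powr_numeral)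
    finally have one: "1 \<le> M\<^sup>2 * (?r\<^sup>2 * ?r powr \<alpha>)" .
    have "bergman_density \<alpha> h z \<le> M\<^sup>2 * (?r\<^sup>2 * ?r powr \<alpha>) * bergman_density \<alpha> h z"
      using mult_right_mono[OF one bergman_density_nonneg[OF \<alpha>, of h z]] by simp
    also have "\<dots> = M\<^sup>2 * (?r\<^sup>2 * bergman_density \<alpha> f (?\<tau> z))"
      unfolding bergman_density_weight wt h[OF z] by (simp add: mult_ac)
    finally show ?thesis by (simp add: norm_deriv_parabolic_flow[OF a z])
  qed
  let ?J = "\<lambda>z. (cmod (deriv ?\<tau> z))\<^sup>2 * bergman_density \<alpha> f (?\<tau> z)"
  have cf: "continuous_on (?\<tau> ` unit_disk) (bergman_density \<alpha> f)"
    unfolding parabolic_flow_image[OF a] by (rule continuous_bergman_density[OF bergman_spaceD(1)[OF \<alpha> f]])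
  have cJ: "continuous_on unit_disk ?J"
    by (intro continuous_intros holomorphic_on_imp_continuous_on holomorphic_deriv
        holomorphic_parabolic_flow[OF a] continuous_on_compose2[OF cf]) auto
  have "(\<lambda>z. ennreal (indicator unit_disk z * ?J z)) \<in> borel_measurable borel"
    using set_borel_measurable_continuous_open[OF open_ball cJ] by (simp add: set_borel_measurable_def)
  moreover have "(\<lambda>z. ennreal (indicator unit_disk z * ?J z)) = (\<lambda>z. ennreal (?J z) * indicator unit_disk z)"
    by (auto simp: indicator_def)
  ultimately have mJ: "(\<lambda>z. ennreal (?J z) * indicator unit_disk z) \<in> borel_measurable borel" by simp
  have "bergman_energy \<alpha> h \<le> (\<integral>\<^sup>+z. ennreal (M\<^sup>2) * (ennreal (?J z) * indicator unit_disk z) \<partial>lborel)"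
    unfolding bergman_energy_def
    using pt by (intro nn_integral_mono) (auto simp: indicator_def ennreal_mult'[symmetric] ennreal_leI)
  also have "\<dots> = ennreal (M\<^sup>2) * (\<integral>\<^sup>+z\<in>unit_disk. ennreal (?J z) \<partial>lborel)"
    using mJ by (subst nn_integral_cmult) auto
  also have "(\<integral>\<^sup>+z\<in>unit_disk. ennreal (?J z) \<partial>lborel) = bergman_energy \<alpha> f"
    using nn_integral_change_of_variables_holomorphic[OF open_ball holomorphic_parabolic_flow[OF a]
        inj_parabolic_flow[OF a] cf] bergman_density_nonneg[OF \<alpha>]
    unfolding parabolic_flow_image[OF a] by (simp add: bergman_energy_def)
  also have "ennreal (M\<^sup>2) * bergman_energy \<alpha> f = ennreal ((M * bergman_norm \<alpha> f)\<^sup>2)"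
    by (simp add: bergman_energy_norm[OF \<alpha> f] ennreal_mult power_mult_distrib)
  finally have E: "bergman_energy \<alpha> h \<le> ennreal ((M * bergman_norm \<alpha> f)\<^sup>2)" .
  show "h \<in> bergman_space \<alpha>" "bergman_norm \<alpha> h \<le> (1 + \<bar>s\<bar>) powr (\<alpha> + 2) * bergman_norm \<alpha> f"
    using bergman_spaceI[OF \<alpha> hh h0 E] M bergman_norm_nonneg[OF \<alpha>] by (auto simp: M_def)
qed

lemma weighted_flow_composition:
  fixes s :: real
  assumes a: "cmod a = 1" and f: "f \<in> bergman_space \<alpha>"
    and u: "u holomorphic_on unit_disk" "\<And>z. z \<in> unit_disk \<Longrightarrow> cmod (u z) \<le> M"
  defines "h \<equiv> weighted_composition u (parabolic_flow a s) f"
  shows "h \<in> bergman_space \<alpha>" "bergman_norm \<alpha> h \<le> M * (1 + \<bar>s\<bar>) powr (\<alpha> + 2) * bergman_norm \<alpha> f"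
proof -
  let ?g = "weighted_composition (\<lambda>_. 1) (parabolic_flow a s) f"
  note g = bergman_flow_composition[OF a f, of s]
  have M: "0 \<le> M" using order_trans[OF norm_ge_zero u(2)[of 0]] by simp
  have "h holomorphic_on unit_disk"
    by (rule holomorphic_transform[OF holomorphic_on_mult[OF u(1) bergman_spaceD(1)[OF \<alpha> g(1)]]])
      (simp add: h_def weighted_composition_def)
  moreover have "h z = 0" if "z \<notin> unit_disk" for z using that by (simp add: h_def weighted_composition_def)
  moreover have "cmod (h z) \<le> M * cmod (?g z)" if "z \<in> unit_disk" for z
    using u(2)[OF that] that by (simp add: h_def weighted_composition_def norm_mult mult_right_mono)
  ultimately have *: "h \<in> bergman_space \<alpha>" "bergman_norm \<alpha> h \<le> M * bergman_norm \<alpha> ?g"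
    using bergman_dominated[OF \<alpha> g(1) _ _ _ M, of h] by blast+
  show "h \<in> bergman_space \<alpha>" by (rule *)
  show "bergman_norm \<alpha> h \<le> M * (1 + \<bar>s\<bar>) powr (\<alpha> + 2) * bergman_norm \<alpha> f"
    using *(2) mult_left_mono[OF g(2) M] by (simp add: mult.assoc)
qed

lemma weighted_flow_operator:
  assumes a: "cmod a = 1"
    and u: "u holomorphic_on unit_disk" "\<And>z. z \<in> unit_disk \<Longrightarrow> cmod (u z) \<le> M"
  shows "bergman_operator \<alpha> (weighted_composition u (parabolic_flow a s))"
  unfolding bergman_operator_def
  by (intro conjI ballI allI exI[of _ "M * (1 + \<bar>s\<bar>) powr (\<alpha> + 2)"] weighted_flow_composition[OF a _ u])
     (auto simp: weighted_composition_def algebra_simps)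

end

section \<open>Orbits, products along orbits and geometric decay\<close>

text \<open>Two such indices differ by at most \<open>2 R / \<bar>s\<bar>\<close>. The bound does not depend on \<open>w\<close>.\<close>

lemma translates_in_disk_bound:
  fixes w :: complex and s R :: real
  assumes s: "s \<noteq> 0"
  defines "J \<equiv> {j::nat. cmod (w + of_real (real j * s)) \<le> R}"
  shows "finite J" "card J \<le> nat \<lceil>2 * R / \<bar>s\<bar>\<rceil> + 1"
proof -
  define L where "L = nat \<lceil>2 * R / \<bar>s\<bar>\<rceil>"
  have "\<exists>m. J \<subseteq> {m..m + L}"
  proof (cases "J = {}")
    case False
    define m where "m = (LEAST j. j \<in> J)"
    have m: "m \<in> J" using False unfolding m_def by (metis LeastI ex_in_conv)
    have "j \<in> {m..m + L}" if j: "j \<in> J" for j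
    proof -
      have mj: "m \<le> j" unfolding m_def using j by (rule Least_le)
      have "cmod (of_real (real j * s) - of_real (real m * s)) =
          cmod ((w + of_real (real j * s)) - (w + of_real (real m * s)))" by simp
      also have "\<dots> \<le> cmod (w + of_real (real j * s)) + cmod (w + of_real (real m * s))"
        by (rule norm_triangle_ineq4)
      also have "\<dots> \<le> 2 * R" using m j by (simp add: J_def)
      finally have "\<bar>(real j - real m) * s\<bar> \<le> 2 * R"
        by (simp only: of_real_diff[symmetric] norm_of_real left_diff_distrib)
      then have "real (j - m) * \<bar>s\<bar> \<le> 2 * R" using mj by (simp add: abs_mult of_nat_diff)
      then have "real (j - m) \<le> 2 * R / \<bar>s\<bar>" using s by (simp add: field_simps)
      then have "j - m \<le> L" unfolding L_def by linarith
      then show ?thesis using mj by auto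
    qed
    then show ?thesis by blast
  qed auto
  then obtain m where m: "J \<subseteq> {m..m + L}" by blast
  show "finite J" using m finite_subset by blast
  show "card J \<le> nat \<lceil>2 * R / \<bar>s\<bar>\<rceil> + 1"
    using card_mono[OF _ m] by (simp add: L_def)
qed

lemma prod_indexed_exception:
  fixes c :: real and n :: nat
  assumes "finite J"
  shows "(\<Prod>j<n. if j \<in> J then c else 1) = c ^ card ({..<n} \<inter> J)"
  by (subst prod.If_cases) (auto simp: Int_def)

text \<open>Up to a factor independent of \<open>n\<close>, boundedly many exceptional factors do not affect a
  geometric bound. The same holds for lower bounds, in the next lemma.\<close>

lemma prod_le_with_exceptions:
  fixes f :: "nat \<Rightarrow> real"
  assumes J: "finite J" "card J \<le> N" and f: "\<And>j. 0 \<le> f j" "\<And>j. f j \<le> M" "\<And>j. j \<notin> J \<Longrightarrow> f j \<le> q"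
    and q: "0 < q" "q \<le> M"
  shows "(\<Prod>j<n. f j) \<le> (M / q) ^ N * q ^ n"
proof -
  have "(\<Prod>j<n. f j) \<le> (\<Prod>j<n. q * (if j \<in> J then M / q else 1))"
    using f q by (intro prod_mono) auto
  also have "\<dots> = q ^ n * (M / q) ^ card ({..<n} \<inter> J)"
    by (simp add: prod.distrib prod_indexed_exception[OF J(1)])
  also have "card ({..<n} \<inter> J) \<le> N" using J card_mono[of J "{..<n} \<inter> J"] by auto
  then have "q ^ n * (M / q) ^ card ({..<n} \<inter> J) \<le> q ^ n * (M / q) ^ N"
    using q by (intro mult_left_mono power_increasing) auto
  finally show ?thesis by (simp add: mult.commute)
qed

lemma prod_ge_with_exceptions:
  fixes f :: "nat \<Rightarrow> real"
  assumes J: "finite J" "card J \<le> N" and f: "\<And>j. d \<le> f j" "\<And>j. j \<notin> J \<Longrightarrow> q \<le> f j"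
    and d: "0 < d" "d \<le> q"
  shows "(d / q) ^ N * q ^ n \<le> (\<Prod>j<n. f j)"
proof -
  have "card ({..<n} \<inter> J) \<le> N" using J card_mono[of J "{..<n} \<inter> J"] by auto
  then have "q ^ n * (d / q) ^ N \<le> q ^ n * (d / q) ^ card ({..<n} \<inter> J)"
    using d by (intro mult_left_mono power_decreasing) auto
  also have "\<dots> = (\<Prod>j<n. q * (if j \<in> J then d / q else 1))"
    by (simp add: prod.distrib prod_indexed_exception[OF J(1)])
  also have "\<dots> \<le> (\<Prod>j<n. f j)"
    using f d by (intro prod_mono) auto
  finally show ?thesis by (simp add: mult.commute)
qed

lemma powr_times_geometric_tendsto_0:
  fixes r b p :: real
  assumes "0 < r" "r < 1" "0 \<le> b" "0 \<le> p"
  shows "(\<lambda>n. (1 + real n * b) powr p * r ^ n) \<longlonglongrightarrow> 0"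
proof (cases "b = 0")
  case True
  then show ?thesis using assms by (simp add: LIMSEQ_power_zero)
next
  case False
  then have "b > 0" using assms by simp
  moreover define c where "c = - ln r"
  moreover have "c > 0" using assms by (simp add: c_def)
  ultimately have "(\<lambda>n. (1 + real n * b) powr p * exp (- c * real n)) \<longlonglongrightarrow> 0"
    by real_asymp
  moreover have "exp (- c * real n) = r ^ n" for n
    using assms by (simp add: c_def exp_of_nat_mult mult.commute[of "ln r"])
  ultimately show ?thesis by simp
qed

lemma summable_powr_times_geometric:
  fixes q b p :: real
  assumes "0 < q" "q < 1" "0 \<le> b" "0 \<le> p"
  shows "summable (\<lambda>n. (1 + real n * b) powr p * q ^ n)"
proof -
  define r where "r = sqrt q"
  have r: "0 < r" "r < 1" "q = r * r" using assms by (auto simp: r_def)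
  have "Bseq (\<lambda>n. (1 + real n * b) powr p * r ^ n)"
    using powr_times_geometric_tendsto_0[OF r(1,2) assms(3,4)] by (auto intro: convergent_imp_Bseq convergentI)
  then obtain K where K: "\<And>n. norm ((1 + real n * b) powr p * r ^ n) \<le> K" by (auto simp: Bseq_def)
  show ?thesis
  proof (rule summable_comparison_test')
    show "summable (\<lambda>n. K * r ^ n)" using r by (intro summable_mult summable_geometric) auto
    fix n
    have "norm ((1 + real n * b) powr p * q ^ n) = norm ((1 + real n * b) powr p * r ^ n) * r ^ n"
      using r by (simp add: power_mult_distrib abs_mult)
    also have "\<dots> \<le> K * r ^ n" using K r by (intro mult_right_mono) auto
    finally show "norm ((1 + real n * b) powr p * q ^ n) \<le> K * r ^ n" .
  qed
qed

text \<open>The Cayley transform is large exactly near \<open>a\<close>.\<close>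

lemma eventually_near_boundary_point:
  assumes a: "cmod a = 1" and P: "eventually P (at a within unit_disk)"
  obtains R where "0 < R" "\<And>z. z \<in> unit_disk \<Longrightarrow> R < cmod (cayley a z) \<Longrightarrow> P z"
proof -
  obtain d where d: "0 < d" "\<And>z. z \<in> unit_disk \<Longrightarrow> z \<noteq> a \<Longrightarrow> dist z a < d \<Longrightarrow> P z"
    using P by (auto simp: eventually_at)
  show ?thesis
  proof
    show "0 < 2 / d + 1" using d by (simp add: add_pos_pos)
    fix z assume z: "z \<in> unit_disk" and R: "2 / d + 1 < cmod (cayley a z)"
    have "cmod (cayley a z) \<le> cmod (cayley a z + \<i>) + 1"
      using norm_triangle_ineq4[of "cayley a z + \<i>" \<i>] by simp
    then have lt: "2 / d < cmod (cayley a z + \<i>)" using R by linarith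
    have nz: "0 < cmod (a - z)" using disk_neq_boundary[OF a z] by simp
    have "cmod (a - z) * (2 / d) < cmod (a - z) * cmod (cayley a z + \<i>)"
      using lt nz by (rule mult_strict_left_mono)
    then have "cmod (a - z) * (2 / d) < 2" using norm_cayley_plus_i[OF a z] by (simp add: mult.commute)
    then have "dist z a < d" using d by (simp add: dist_norm norm_minus_commute field_simps)
    then show "P z" using d z nz by auto
  qed
qed

text \<open>Some function of modulus at most 1 vanishes on the whole orbit of \<open>z0\<close> except at \<open>z0\<close>, where it
  is not too small. In the half-plane, \<open>w \<mapsto> exp (\<kappa> w)\<close> with \<open>\<kappa> = 2 \<pi> \<i> / \<bar>t\<bar>\<close> has period \<open>t\<close>, so its
  difference quotient at \<open>w0\<close> vanishes at all other points \<open>w0 + k t\<close>. The quotient is at most \<open>\<bar>\<kappa>\<bar>\<close>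
  because \<open>\<bar>exp (\<kappa> w)\<bar> \<le> 1\<close> on the half-plane, and at \<open>w0\<close> it is the derivative, whose modulus is
  bounded below as long as \<open>w0\<close> stays in a bounded set.\<close>

lemma orbit_separating_function:
  assumes a: "cmod a = 1" and t: "t \<noteq> 0" and z0: "z0 \<in> unit_disk" and R: "cmod (cayley a z0) \<le> R"
  obtains B where "B holomorphic_on unit_disk" "\<And>z. z \<in> unit_disk \<Longrightarrow> cmod (B z) \<le> 1"
    "exp (- (2 * pi * R / \<bar>t\<bar>)) \<le> cmod (B z0)"
    "\<And>k::int. k \<noteq> 0 \<Longrightarrow> B (parabolic_flow a (of_int k * t) z0) = 0"
proof -
  define \<kappa> where "\<kappa> = 2 * of_real pi * \<i> / of_real \<bar>t\<bar>"
  define w0 where "w0 = cayley a z0"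
  define E where "E = (\<lambda>w. exp (\<kappa> * w))"
  define h where "h = (\<lambda>w. if w = w0 then deriv E w0 else (E w - E w0) / (w - w0))"
  define H where "H = {w::complex. Im w > 0}"
  have n\<kappa>: "cmod \<kappa> = 2 * pi / \<bar>t\<bar>" by (simp add: \<kappa>_def norm_mult norm_divide)
  have \<kappa>: "0 < cmod \<kappa>" using t by (simp add: n\<kappa>)
  have w0: "w0 \<in> H" using Im_cayley_pos[OF a z0] by (simp add: w0_def H_def)
  have dE: "(E has_field_derivative \<kappa> * E w) (at w within S)" for w S
    unfolding E_def by (auto intro!: derivative_eq_intros)
  have ReK: "Re (\<kappa> * w) = - cmod \<kappa> * Im w" for w
  proof -
    have "\<kappa> = \<i> * of_real (2 * pi / \<bar>t\<bar>)" by (simp add: \<kappa>_def)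
    then show ?thesis unfolding n\<kappa> by simp
  qed
  have nE: "cmod (E w) = exp (- cmod \<kappa> * Im w)" for w
    by (simp only: E_def norm_exp_eq_Re ReK)
  have dE0: "deriv E w0 = \<kappa> * E w0" using dE by (rule DERIV_imp_deriv)
  have lip: "cmod (E w - E w0) \<le> cmod \<kappa> * cmod (w - w0)" if w: "w \<in> H" for w
  proof (rule field_differentiable_bound[where S=H])
    show "convex H" unfolding H_def by (rule convex_halfspace_Im_gt)
    show "(E has_field_derivative \<kappa> * E v) (at v within H)" for v by (rule dE)
    show "cmod (\<kappa> * E v) \<le> cmod \<kappa>" if "v \<in> H" for v
      using that by (simp add: norm_mult nE mult_left_le H_def)
  qed (use w w0 in auto)
  have hH: "cmod (h w) \<le> cmod \<kappa>" if w: "w \<in> H" for w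
  proof (cases "w = w0")
    case True
    then show ?thesis using w0 by (simp add: h_def dE0 norm_mult nE mult_left_le H_def)
  next
    case False
    then show ?thesis using lip[OF w] by (simp add: h_def norm_divide divide_le_eq)
  qed
  have hol: "h holomorphic_on UNIV"
    unfolding h_def by (rule pole_lemma_open) (auto simp: E_def intro!: holomorphic_intros)
  show ?thesis
  proof
    let ?B = "\<lambda>z. h (cayley a z) / \<kappa>"
    show "?B holomorphic_on unit_disk"
      using \<kappa> holomorphic_on_compose_gen[OF holomorphic_cayley[OF a] hol]
      by (intro holomorphic_intros) (auto simp: o_def)
    show "cmod (?B z) \<le> 1" if "z \<in> unit_disk" for z
      using hH[of "cayley a z"] Im_cayley_pos[OF a that] \<kappa> by (simp add: H_def norm_divide divide_le_eq)
    have "Im w0 \<le> R" using R abs_Im_le_cmod[of w0] by (simp add: w0_def)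
    then have "cmod \<kappa> * Im w0 \<le> cmod \<kappa> * R" by (rule mult_left_mono) simp
    then have "exp (- (2 * pi * R / \<bar>t\<bar>)) \<le> cmod (E w0)"
      by (simp add: nE n\<kappa>)
    then show "exp (- (2 * pi * R / \<bar>t\<bar>)) \<le> cmod (?B z0)"
      using \<kappa> by (simp add: w0_def[symmetric] h_def dE0 norm_divide norm_mult)
    show "?B (parabolic_flow a (of_int k * t) z0) = 0" if k: "k \<noteq> 0" for k :: int
    proof -
      let ?s = "complex_of_real (of_int k * t)"
      have s0: "?s \<noteq> 0" using k t by simp
      have "\<kappa> * ?s = 2 * of_int (if t > 0 then k else - k) * of_real pi * \<i>"
        using t by (simp add: \<kappa>_def)
      then have "exp (\<kappa> * ?s) = 1" unfolding exp_eq_1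
        by (auto intro!: exI[of _ "if t > 0 then k else - k"])
      then have "E (w0 + ?s) = E w0" by (simp add: E_def distrib_left exp_add)
      moreover have "cayley a (parabolic_flow a (of_int k * t) z0) = w0 + ?s"
        using cayley_flow[OF a z0] by (simp add: w0_def)
      ultimately show ?thesis using s0 by (simp add: h_def)
    qed
  qed
qed

section \<open>The spectrum of a weighted composition with a flow\<close>

context
  fixes \<alpha> :: real assumes \<alpha>: "\<alpha> > -1"
begin

context
  fixes a :: complex and t :: real
  assumes a: "cmod a = 1"
begin

lemma weighted_flow_iterate:
  assumes u: "u holomorphic_on unit_disk" "\<And>z. z \<in> unit_disk \<Longrightarrow> cmod (u z) \<le> M" and f: "f \<in> bergman_space \<alpha>"
  shows "(weighted_composition u (parabolic_flow a t) ^^ n) f =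
    weighted_composition (\<lambda>z. \<Prod>j<n. u (parabolic_flow a (real j * t) z)) (parabolic_flow a (real n * t)) f"
proof (induction n)
  case 0
  then show ?case
    using bergman_spaceD(2)[OF \<alpha> f] by (auto simp: weighted_composition_def fun_eq_iff parabolic_flow_0[OF a])
next
  case (Suc n)
  have "(\<Prod>j<Suc n. u (parabolic_flow a (real j * t) z)) =
      u z * (\<Prod>j<n. u (parabolic_flow a (real j * t) (parabolic_flow a t z)))" if "z \<in> unit_disk" for z
    using that by (simp only: prod.lessThan_Suc_shift) (simp add: parabolic_flow_0[OF a] parabolic_flow_add[OF a] algebra_simps)
  moreover have "parabolic_flow a (real n * t) (parabolic_flow a t z) = parabolic_flow a (real (Suc n) * t) z"
    if "z \<in> unit_disk" for z
    using that by (simp add: parabolic_flow_add[OF a] algebra_simps)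
  ultimately show ?case
    using Suc parabolic_flow_in_disk[OF a]
    by (simp del: prod.lessThan_Suc of_nat_Suc add: weighted_composition_def fun_eq_iff)
qed

text \<open>The spectral radius bound: all but boundedly many factors of the weight of the \<open>n\<close>-th
  iterate are at most \<open>q\<close>, and composition with the \<open>n\<close>-th iterate grows polynomially.\<close>

lemma weighted_flow_resolvent:
  assumes t: "t \<noteq> 0"
    and u: "u holomorphic_on unit_disk" "\<And>z. z \<in> unit_disk \<Longrightarrow> cmod (u z) \<le> M"
    and q: "0 < q" "q < 1" and far: "\<And>z. z \<in> unit_disk \<Longrightarrow> R < cmod (cayley a z) \<Longrightarrow> cmod (u z) \<le> q"
  shows "bergman_invertible \<alpha> (\<lambda>f z. f z - weighted_composition u (parabolic_flow a t) f z)"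
proof -
  define M' where "M' = max M q"
  define N where "N = nat \<lceil>2 * R / \<bar>t\<bar>\<rceil> + 1"
  define c where "c = (\<lambda>n. (M' / q) ^ N * ((1 + real n * \<bar>t\<bar>) powr (\<alpha> + 2) * q ^ n))"
  have M': "0 < M'" "q \<le> M'" "M \<le> M'" using q by (auto simp: M'_def)
  have prod: "cmod (\<Prod>j<n. u (parabolic_flow a (real j * t) z)) \<le> (M' / q) ^ N * q ^ n" if z: "z \<in> unit_disk" for z n
  proof -
    define J where "J = {j::nat. cmod (cayley a z + of_real (real j * t)) \<le> R}"
    have "(\<Prod>j<n. cmod (u (parabolic_flow a (real j * t) z))) \<le> (M' / q) ^ N * q ^ n"
    proof (rule prod_le_with_exceptions)
      show "finite J" "card J \<le> N"
        using translates_in_disk_bound[OF t, of "cayley a z" R] by (simp_all add: J_def N_def)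
      fix j
      note zj = parabolic_flow_in_disk[OF a z, of "real j * t"]
      show "cmod (u (parabolic_flow a (real j * t) z)) \<le> M'" using u(2)[OF zj] M'(3) by linarith
      show "cmod (u (parabolic_flow a (real j * t) z)) \<le> q" if "j \<notin> J"
        using that far[OF zj] cayley_flow[OF a z] by (simp add: J_def)
    qed (use q M' in auto)
    then show ?thesis by (simp add: prod_norm)
  qed
  show ?thesis
  proof (rule bergman_neumann_series[OF \<alpha> weighted_flow_operator[OF \<alpha> a u]])
    have "0 < 1 + real n * \<bar>t\<bar>" for n by (simp add: add_pos_nonneg)
    then show "0 < c n" for n using M' q by (simp add: c_def less_imp_neq[THEN not_sym])
    show "summable c" unfolding c_def
      using q \<alpha> by (intro summable_mult summable_powr_times_geometric) auto
    fix n f assume f: "f \<in> bergman_space \<alpha>"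
    have hol: "(\<lambda>z. \<Prod>j<n. u (parabolic_flow a (real j * t) z)) holomorphic_on unit_disk"
      by (intro holomorphic_intros holomorphic_on_compose_gen[OF holomorphic_parabolic_flow[OF a] u(1), unfolded o_def])
        (simp add: parabolic_flow_image[OF a])
    have it: "(weighted_composition u (parabolic_flow a t) ^^ n) f =
      weighted_composition (\<lambda>z. \<Prod>j<n. u (parabolic_flow a (real j * t) z)) (parabolic_flow a (real n * t)) f"
      by (rule weighted_flow_iterate[OF u f])
    show "bergman_norm \<alpha> ((weighted_composition u (parabolic_flow a t) ^^ n) f) \<le> c n * bergman_norm \<alpha> f"
      unfolding it
      using weighted_flow_composition(2)[OF \<alpha> a f hol prod, of "real n * t"]
      by (simp add: c_def abs_mult mult_ac)
  qed auto
qed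

text \<open>The inverse is again a weighted composition, along the reversed flow.\<close>

lemma weighted_flow_invertible:
  assumes u: "u holomorphic_on unit_disk" "\<And>z. z \<in> unit_disk \<Longrightarrow> cmod (u z) \<le> M"
    and d: "0 < d" "\<And>z. z \<in> unit_disk \<Longrightarrow> d \<le> cmod (u z)"
  shows "bergman_invertible \<alpha> (weighted_composition u (parabolic_flow a t))"
proof -
  define v where "v = (\<lambda>z. 1 / u (parabolic_flow a (- t) z))"
  note fd = parabolic_flow_in_disk[OF a]
  have unz: "u z \<noteq> 0" if "z \<in> unit_disk" for z using d(1) d(2)[OF that] by auto
  have v: "v holomorphic_on unit_disk"
    unfolding v_def using unz fd
    by (intro holomorphic_intros holomorphic_on_compose_gen[OF holomorphic_parabolic_flow[OF a] u(1), unfolded o_def])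
      (auto simp: parabolic_flow_image[OF a])
  have vM: "cmod (v z) \<le> 1 / d" if "z \<in> unit_disk" for z
    using d(1) d(2)[OF fd[OF that]] by (simp add: v_def norm_divide frac_le)
  have "weighted_composition v (parabolic_flow a (- t)) (weighted_composition u (parabolic_flow a t) f) = f \<and>
    weighted_composition u (parabolic_flow a t) (weighted_composition v (parabolic_flow a (- t)) f) = f"
    if f: "f \<in> bergman_space \<alpha>" for f
    using bergman_spaceD(2)[OF \<alpha> f] unz fd
    by (auto simp: weighted_composition_def fun_eq_iff v_def parabolic_flow_add[OF a] parabolic_flow_0[OF a])
  then show ?thesis
    unfolding bergman_invertible_def
    using weighted_flow_operator[OF \<alpha> a u] weighted_flow_operator[OF \<alpha> a v vM] by blast
qed

text \<open>A solution \<open>g\<close> of \<open>u (g \<circ> \<tau>) - \<mu> g = f\<close> is forced to grow exponentially along a backward orbit,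
  if \<open>f\<close> vanishes there except at a starting point where \<open>u\<close> is small. The starting point is the last
  point of the backward orbit where \<open>u\<close> is smaller than a threshold \<open>d\<close>: then all later factors are
  at least \<open>d\<close>, and all but boundedly many of them are at least \<open>\<rho>\<close>.\<close>

theorem weighted_flow_not_invertible:
  assumes t: "t \<noteq> 0"
    and u: "u holomorphic_on unit_disk" "\<And>z. z \<in> unit_disk \<Longrightarrow> cmod (u z) \<le> M"
    and \<mu>: "0 < cmod \<mu>" "cmod \<mu> < \<rho>"
    and far: "\<And>z. z \<in> unit_disk \<Longrightarrow> R < cmod (cayley a z) \<Longrightarrow> \<rho> \<le> cmod (u z)"
    and small: "\<And>d. 0 < d \<Longrightarrow> \<exists>z\<in>unit_disk. cmod (u z) < d"
  shows "\<not> bergman_invertible \<alpha> (\<lambda>f z. weighted_composition u (parabolic_flow a t) f z - \<mu> * f z)"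
proof
  let ?C = "weighted_composition u (parabolic_flow a t)"
  assume "bergman_invertible \<alpha> (\<lambda>f z. ?C f z - \<mu> * f z)"
  then obtain S where S: "bergman_operator \<alpha> S"
    and inv: "\<And>f. f \<in> bergman_space \<alpha> \<Longrightarrow> (\<lambda>z. ?C (S f) z - \<mu> * S f z) = f"
    by (auto simp: bergman_invertible_def)
  obtain K where K: "K \<ge> 0" "\<And>f. f \<in> bergman_space \<alpha> \<Longrightarrow> bergman_norm \<alpha> (S f) \<le> K * bergman_norm \<alpha> f"
    using bergman_operatorD(4)[OF \<alpha> S] by blast
  define c where "c = exp (- (2 * pi * R / \<bar>t\<bar>))"
  define P where "P = (1 + \<bar>t\<bar>) powr (\<alpha> + 2)"
  \<comment> \<open>so small that at the starting point the term with \<open>u\<close> takes up at most half of \<open>f\<close>\<close>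
  define d where "d = min \<rho> (c / (4 * P * (K + 1)))"
  have c: "0 < c" by (simp add: c_def)
  have P: "0 < P" by (simp add: P_def add_pos_nonneg)
  have \<rho>: "0 < \<rho>" using \<mu> by linarith
  have d: "0 < d" "d \<le> \<rho>" using \<rho> c P K(1) by (auto simp: d_def)
  have dK: "d * (2 * P * K) \<le> c / 2"
  proof -
    define X where "X = 2 * P * (K + 1)"
    have X: "0 < X" "2 * P * K \<le> X" using P K(1) by (auto simp: X_def)
    have "d * (2 * P * K) \<le> c / (2 * X) * X"
      using X c P K(1) d(1) by (intro mult_mono) (auto simp: d_def X_def)
    then show ?thesis using X(1) by simp
  qed

  obtain z1 where z1: "z1 \<in> unit_disk" "cmod (u z1) < d" using small[OF d(1)] by auto
  define J1 where "J1 = {j::nat. cmod (u (parabolic_flow a (real j * (- t)) z1)) < d}"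
  have "J1 \<subseteq> {j::nat. cmod (cayley a z1 + of_real (real j * (- t))) \<le> R}"
  proof
    fix j assume j: "j \<in> J1"
    then have "\<not> R < cmod (cayley a (parabolic_flow a (real j * (- t)) z1))"
      using far[OF parabolic_flow_in_disk[OF a z1(1)], of "real j * (- t)"] d(2) by (auto simp: J1_def)
    then show "j \<in> {j::nat. cmod (cayley a z1 + of_real (real j * (- t))) \<le> R}"
      using cayley_flow[OF a z1(1), of "real j * (- t)"] by simp
  qed
  then have fin: "finite J1" using translates_in_disk_bound(1)[of "- t"] t finite_subset by (metis neg_equal_0_iff_equal)
  have "0 \<in> J1" using z1 by (simp add: J1_def parabolic_flow_0[OF a])
  define m where "m = Max J1"
  have mJ: "m \<in> J1" unfolding m_def using fin \<open>0 \<in> J1\<close> by (intro Max_in) auto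
  have mmax: "j \<notin> J1" if "m < j" for j using that fin unfolding m_def by (meson Max_ge not_le)
  define z0 where "z0 = parabolic_flow a (real m * (- t)) z1"
  define z where "z = (\<lambda>n::nat. parabolic_flow a (real n * (- t)) z0)"
  have z0: "z0 \<in> unit_disk" unfolding z0_def by (rule parabolic_flow_in_disk[OF a z1(1)])
  have zD: "z n \<in> unit_disk" for n unfolding z_def by (rule parabolic_flow_in_disk[OF a z0])
  have z_0: "z 0 = z0" by (simp add: z_def parabolic_flow_0[OF a z0])
  have zback: "parabolic_flow a t (z (Suc n)) = z n" for n
    unfolding z_def using parabolic_flow_add[OF a z0] by (simp add: algebra_simps)
  have zz1: "z n = parabolic_flow a (real (m + n) * (- t)) z1" for n
    unfolding z_def z0_def using parabolic_flow_add[OF a z1(1)] by (simp add: algebra_simps)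
  have u0: "cmod (u z0) < d" using mJ by (simp add: J1_def z0_def)
  have un: "d \<le> cmod (u (z (Suc n)))" for n
    using mmax[of "m + Suc n"] unfolding zz1 J1_def by simp
  have R0: "cmod (cayley a z0) \<le> R" using far[OF z0] u0 d(2) by force

  obtain B where B: "B holomorphic_on unit_disk" "\<And>z. z \<in> unit_disk \<Longrightarrow> cmod (B z) \<le> 1"
    "c \<le> cmod (B z0)" "\<And>k::int. k \<noteq> 0 \<Longrightarrow> B (parabolic_flow a (of_int k * t) z0) = 0"
    using orbit_separating_function[OF a t z0 R0] unfolding c_def by metis
  have Bz: "B (z (Suc n)) = 0" for n
  proof -
    have "of_int (- int (Suc n)) * t = real (Suc n) * (- t)" by (simp add: algebra_simps)
    moreover have "B (parabolic_flow a (of_int (- int (Suc n)) * t) z0) = 0" by (rule B(4)) simp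
    ultimately show ?thesis by (simp only: z_def)
  qed
  obtain g0 where g0: "g0 \<in> bergman_space \<alpha>" "bergman_norm \<alpha> g0 \<le> 1" "g0 z0 \<noteq> 0"
    "\<And>f. f \<in> bergman_space \<alpha> \<Longrightarrow> cmod (f z0) \<le> 2 * cmod (g0 z0) * bergman_norm \<alpha> f"
    using bergman_near_extremal[OF \<alpha> z0] by metis
  define e where "e = cmod (g0 z0)"
  have e: "0 < e" using g0 by (simp add: e_def)
  define f where "f = (\<lambda>z. B z * g0 z)"
  have f: "f \<in> bergman_space \<alpha>" and nf: "bergman_norm \<alpha> f \<le> 1"
  proof -
    have "f holomorphic_on unit_disk"
      unfolding f_def by (intro holomorphic_intros B bergman_spaceD(1)[OF \<alpha> g0(1)])
    moreover have "f z = 0" if "z \<notin> unit_disk" for z using bergman_spaceD(2)[OF \<alpha> g0(1) that] by (simp add: f_def)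
    moreover have "cmod (f z) \<le> 1 * cmod (g0 z)" if "z \<in> unit_disk" for z
      using mult_right_mono[OF B(2)[OF that] norm_ge_zero[of "g0 z"]] by (simp add: f_def norm_mult)
    ultimately have "f \<in> bergman_space \<alpha>" "bergman_norm \<alpha> f \<le> 1 * bergman_norm \<alpha> g0"
      using bergman_dominated[OF \<alpha> g0(1), of f 1] by auto
    then show "f \<in> bergman_space \<alpha>" "bergman_norm \<alpha> f \<le> 1" using g0(2) by auto
  qed
  define g where "g = S f"
  have g: "g \<in> bergman_space \<alpha>" unfolding g_def by (rule bergman_operatorD(1)[OF \<alpha> S f])
  have ng: "bergman_norm \<alpha> g \<le> K"
    unfolding g_def using K(2)[OF f] mult_left_mono[OF nf K(1)] by simp
  have eq: "u w * g (parabolic_flow a t w) - \<mu> * g w = f w" if "w \<in> unit_disk" for w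
    using fun_cong[OF inv[OF f], of w] that by (simp add: g_def weighted_composition_def)
  \<comment> \<open>evaluation at another orbit point is evaluation at \<open>z0\<close> of a composition with the flow\<close>
  have growth: "cmod (g (parabolic_flow a s z0)) \<le> 2 * e * ((1 + \<bar>s\<bar>) powr (\<alpha> + 2) * K)" for s
  proof -
    let ?h = "weighted_composition (\<lambda>_. 1) (parabolic_flow a s) g"
    note h = bergman_flow_composition[OF \<alpha> a g, of s]
    have "cmod (g (parabolic_flow a s z0)) = cmod (?h z0)" using z0 by (simp add: weighted_composition_def)
    also have "\<dots> \<le> 2 * e * bergman_norm \<alpha> ?h" using g0(4)[OF h(1)] by (simp add: e_def)
    also have "\<dots> \<le> 2 * e * ((1 + \<bar>s\<bar>) powr (\<alpha> + 2) * bergman_norm \<alpha> g)"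
      using h(2) e by (intro mult_left_mono) auto
    also have "\<dots> \<le> 2 * e * ((1 + \<bar>s\<bar>) powr (\<alpha> + 2) * K)"
      using ng e by (intro mult_left_mono) auto
    finally show ?thesis .
  qed

  have start: "c * e / 2 \<le> cmod \<mu> * cmod (g z0)"
  proof -
    have "c * e \<le> cmod (f z0)" using B(3) e by (simp add: f_def norm_mult e_def)
    also have "f z0 = u z0 * g (parabolic_flow a t z0) - \<mu> * g z0" using eq[OF z0] by simp
    also have "cmod \<dots> \<le> cmod (u z0 * g (parabolic_flow a t z0)) + cmod (\<mu> * g z0)"
      by (rule norm_triangle_ineq4)
    also have "cmod (u z0 * g (parabolic_flow a t z0)) \<le> d * (2 * e * (P * K))"
      unfolding norm_mult using u0 growth[of t] d by (intro mult_mono) (auto simp: P_def)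
    also have "d * (2 * e * (P * K)) = d * (2 * P * K) * e" by simp
    also have "\<dots> \<le> c / 2 * e" using dK e by (intro mult_right_mono) auto
    finally show ?thesis by (simp add: norm_mult)
  qed
  define N where "N = nat \<lceil>2 * R / \<bar>t\<bar>\<rceil> + 1"
  have rec: "cmod \<mu> ^ n * cmod (g (z n)) = (\<Prod>j<n. cmod (u (z (Suc j)))) * cmod (g z0)" for n
  proof (induction n)
    case (Suc n)
    have "u (z (Suc n)) * g (z n) = \<mu> * g (z (Suc n))"
      using eq[OF zD[of "Suc n"]] by (simp add: zback f_def Bz)
    then have "cmod (u (z (Suc n))) * cmod (g (z n)) = cmod \<mu> * cmod (g (z (Suc n)))"
      by (metis norm_mult)
    then have "cmod \<mu> ^ Suc n * cmod (g (z (Suc n))) = (cmod \<mu> ^ n * cmod (g (z n))) * cmod (u (z (Suc n)))"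
      by (simp add: mult_ac)
    then show ?case using Suc by (simp add: mult_ac)
  qed (simp add: z_0)
  have lower: "(d / \<rho>) ^ N * \<rho> ^ n \<le> (\<Prod>j<n. cmod (u (z (Suc j))))" for n
  proof -
    define J where "J = {j::nat. cmod ((cayley a z0 - of_real t) + of_real (real j * (- t))) \<le> R}"
    show ?thesis
    proof (rule prod_ge_with_exceptions)
      show "finite J" "card J \<le> N"
        using translates_in_disk_bound[of "- t" "cayley a z0 - of_real t" R] t by (simp_all add: J_def N_def)
      show "d \<le> cmod (u (z (Suc j)))" for j by (rule un)
      show "\<rho> \<le> cmod (u (z (Suc j)))" if "j \<notin> J" for j
      proof (rule far[OF zD])
        have "cayley a (z (Suc j)) = (cayley a z0 - of_real t) + of_real (real j * (- t))"
          unfolding z_def cayley_flow[OF a z0] by (simp add: algebra_simps)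
        then show "R < cmod (cayley a (z (Suc j)))" using that by (simp add: J_def)
      qed
    qed (use d in auto)
  qed
  define r where "r = cmod \<mu> / \<rho>"
  have r: "0 < r" "r < 1" using \<mu> \<rho> by (auto simp: r_def)
  define A where "A = (d / \<rho>) ^ N * (c / 2)"
  have A: "0 < A" using d \<rho> c by (simp add: A_def)
  have bound: "A \<le> (2 * K * cmod \<mu>) * ((1 + real n * \<bar>t\<bar>) powr (\<alpha> + 2) * r ^ n)" for n
  proof -
    have "A * e * \<rho> ^ n = ((d / \<rho>) ^ N * \<rho> ^ n) * (c * e / 2)" by (simp add: A_def)
    also have "\<dots> \<le> (\<Prod>j<n. cmod (u (z (Suc j)))) * (cmod \<mu> * cmod (g z0))"
      using lower[of n] start c e by (intro mult_mono) (auto intro: prod_nonneg)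
    also have "\<dots> = cmod \<mu> ^ n * cmod (g (z n)) * cmod \<mu>" using rec[of n] by simp
    also have "\<dots> \<le> cmod \<mu> ^ n * (2 * e * ((1 + real n * \<bar>t\<bar>) powr (\<alpha> + 2) * K)) * cmod \<mu>"
      using growth[of "real n * (- t)"]
      by (intro mult_right_mono mult_left_mono) (auto simp: z_def abs_mult)
    also have "\<dots> = ((2 * K * cmod \<mu>) * ((1 + real n * \<bar>t\<bar>) powr (\<alpha> + 2) * r ^ n)) * e * \<rho> ^ n"
      using \<rho> by (simp add: r_def power_divide)
    finally show ?thesis using e \<rho> by simp
  qed
  have "(\<lambda>n. (2 * K * cmod \<mu>) * ((1 + real n * \<bar>t\<bar>) powr (\<alpha> + 2) * r ^ n)) \<longlonglongrightarrow> 0"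
    using r \<alpha> by (intro tendsto_mult_right_zero powr_times_geometric_tendsto_0) auto
  then have "A \<le> 0" using bound by (intro LIMSEQ_le_const) auto
  then show False using A by simp
qed

end

end

theorem theorem4p2p2:
  fixes \<alpha> :: real and \<phi> \<psi> :: "complex \<Rightarrow> complex" and a \<psi>a :: complex
  assumes "\<alpha> > -1"
    and "parabolic_automorphism \<phi>"
    and "a \<in> sphere 0 1" and "denjoy_wolff_point \<phi> a"
    and "\<psi> \<in> H_infinity"
    and "\<exists>z\<in>unit_disk. \<psi> z \<noteq> 0"
    and "(\<psi> \<longlongrightarrow> \<psi>a) (at a within unit_disk)"
    and "\<not> bergman_invertible \<alpha> (weighted_composition \<psi> \<phi>)"
  shows "bergman_spectrum \<alpha> (weighted_composition \<psi> \<phi>) = {\<mu>. cmod \<mu> \<le> cmod \<psi>a}"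
proof -
  note \<alpha> = assms(1)
  have a: "cmod a = 1" using assms(3) by simp
  obtain t where t: "t \<noteq> 0" and flow: "\<And>z. z \<in> unit_disk \<Longrightarrow> \<phi> z = parabolic_flow a t z"
    using parabolic_automorphism_is_flow[OF assms(2) a assms(4)] by metis
  define C where "C = weighted_composition \<psi> (parabolic_flow a t)"
  have C: "weighted_composition \<psi> \<phi> = C"
    by (auto simp: C_def weighted_composition_def flow fun_eq_iff)
  have hol: "\<psi> holomorphic_on unit_disk" and bdd: "bounded (\<psi> ` unit_disk)"
    using assms(5) by (auto simp: H_infinity_def)
  obtain M where "\<And>w. w \<in> \<psi> ` unit_disk \<Longrightarrow> cmod w \<le> M" using bdd unfolding bounded_iff by blast
  then have \<psi>: "\<psi> holomorphic_on unit_disk" "\<And>z. z \<in> unit_disk \<Longrightarrow> cmod (\<psi> z) \<le> M"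
    using hol by blast+
  note lim = tendsto_norm[OF assms(7)]
  have small: "\<exists>z\<in>unit_disk. cmod (\<psi> z) < d" if "0 < d" for d
    using weighted_flow_invertible[OF \<alpha> a \<psi> that] assms(8) unfolding C C_def by (meson not_le)
  have inner: "\<not> bergman_invertible \<alpha> (\<lambda>f z. C f z - \<mu> * f z)" if \<mu>: "0 < cmod \<mu>" "cmod \<mu> < cmod \<psi>a" for \<mu>
  proof -
    obtain \<rho> where \<rho>: "cmod \<mu> < \<rho>" "\<rho> < cmod \<psi>a" using dense[OF \<mu>(2)] by blast
    obtain R where R: "\<And>z. z \<in> unit_disk \<Longrightarrow> R < cmod (cayley a z) \<Longrightarrow> \<rho> < cmod (\<psi> z)"
      using eventually_near_boundary_point[OF a order_tendstoD(1)[OF lim \<rho>(2)]] by metis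
    show ?thesis
      unfolding C_def
    proof (rule weighted_flow_not_invertible[OF \<alpha> a t \<psi> \<mu>(1) \<rho>(1) _ small])
      show "\<rho> \<le> cmod (\<psi> z)" if "z \<in> unit_disk" "R < cmod (cayley a z)" for z
        using R[OF that] by simp
    qed auto
  qed
  have le: "\<not> bergman_invertible \<alpha> (\<lambda>f z. C f z - \<mu> * f z)" if \<mu>: "cmod \<mu> \<le> cmod \<psi>a" for \<mu>
  proof (cases "\<mu> = 0")
    case True
    then show ?thesis using assms(8) by (simp add: C)
  next
    case False
    show ?thesis
    proof
      assume inv: "bergman_invertible \<alpha> (\<lambda>f z. C f z - \<mu> * f z)"
      obtain \<epsilon> where \<epsilon>: "0 < \<epsilon>"
        "\<forall>\<nu>. cmod \<nu> < \<epsilon> \<longrightarrow> bergman_invertible \<alpha> (\<lambda>f z. (C f z - \<mu> * f z) - \<nu> * f z)"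
        using bergman_invertible_stable[OF \<alpha> inv] by (elim exE conjE)
      define s where "s = min (1/2) (\<epsilon> / (2 * cmod \<mu>))"
      have s: "0 < s" "s < 1" using \<epsilon>(1) False by (auto simp: s_def)
      have "s * cmod \<mu> \<le> \<epsilon> / (2 * cmod \<mu>) * cmod \<mu>" by (intro mult_right_mono) (auto simp: s_def)
      then have "cmod (- (of_real s * \<mu>)) < \<epsilon>" using \<epsilon>(1) False s by (simp add: norm_mult)
      from \<epsilon>(2)[rule_format, OF this] have "bergman_invertible \<alpha> (\<lambda>f z. C f z - (of_real (1 - s) * \<mu>) * f z)"
        by (simp add: algebra_simps)
      moreover have n: "cmod (of_real (1 - s) * \<mu>) = (1 - s) * cmod \<mu>"
        using s by (simp add: norm_mult del: of_real_diff)
      have "(1 - s) * cmod \<mu> < cmod \<mu>" using s False by (simp add: algebra_simps)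
      then have "\<not> bergman_invertible \<alpha> (\<lambda>f z. C f z - (of_real (1 - s) * \<mu>) * f z)"
        using s False \<mu> by (intro inner) (auto simp only: n zero_less_mult_iff zero_less_norm_iff)
      ultimately show False by contradiction
    qed
  qed
  have gt: "bergman_invertible \<alpha> (\<lambda>f z. C f z - \<mu> * f z)" if \<mu>: "cmod \<psi>a < cmod \<mu>" for \<mu>
  proof -
    have \<mu>0: "0 < cmod \<mu>" using \<mu> norm_ge_zero[of \<psi>a] by linarith
    then have \<mu>nz: "\<mu> \<noteq> 0" by auto
    obtain p where p: "cmod \<psi>a < p" "p < cmod \<mu>" using dense[OF \<mu>] by blast
    have p0: "0 < p" using p norm_ge_zero[of \<psi>a] by linarith
    obtain R where R: "\<And>z. z \<in> unit_disk \<Longrightarrow> R < cmod (cayley a z) \<Longrightarrow> cmod (\<psi> z) < p"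
      using eventually_near_boundary_point[OF a order_tendstoD(2)[OF lim p(1)]] by metis
    have "bergman_invertible \<alpha> (\<lambda>f z. f z - weighted_composition (\<lambda>z. \<psi> z / \<mu>) (parabolic_flow a t) f z)"
    proof (rule weighted_flow_resolvent[OF \<alpha> a t])
      show "(\<lambda>z. \<psi> z / \<mu>) holomorphic_on unit_disk" using \<mu>nz by (intro holomorphic_intros \<psi>) auto
      show "cmod (\<psi> z / \<mu>) \<le> M / cmod \<mu>" if "z \<in> unit_disk" for z
        using \<psi>(2)[OF that] \<mu>0 by (simp add: norm_divide divide_right_mono)
      show "cmod (\<psi> z / \<mu>) \<le> p / cmod \<mu>" if "z \<in> unit_disk" "R < cmod (cayley a z)" for z
        using R[OF that] \<mu>0 by (simp add: norm_divide divide_right_mono)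
    qed (use p p0 \<mu>0 in auto)
    from bergman_invertible_compose[OF \<alpha> bergman_invertible_scale[OF \<alpha>, of "- \<mu>"] this]
    have "bergman_invertible \<alpha>
        (\<lambda>f z. - \<mu> * (f z - weighted_composition (\<lambda>z. \<psi> z / \<mu>) (parabolic_flow a t) f z))"
      using \<mu>nz by simp
    also have "(\<lambda>f z. - \<mu> * (f z - weighted_composition (\<lambda>z. \<psi> z / \<mu>) (parabolic_flow a t) f z)) =
        (\<lambda>f z. C f z - \<mu> * f z)"
      using \<mu>nz by (auto simp: C_def weighted_composition_def fun_eq_iff algebra_simps)
    finally show ?thesis .
  qed
  show ?thesis
    unfolding bergman_spectrum_def C using le gt by (auto simp: not_le[symmetric])
qed

end
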